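(* Let $G$ be a finite group and let $Z$, $X$ be finite homogeneous $G$-spaces. Let $\Theta\subseteq C_2^Z$ be a system of representatives for the orbits of $G$ on $C_2^Z$. For each $\theta\in\Theta$ let \[ L(X)=\bigoplus_{i=0}^{n(\theta)}m_{\theta,i}V_{\theta,i} \] be the decomposition of $L(X)$ into irreducible $G_\theta$-representations (the $V_{\theta,i}$, for different $i$, being inequivalent and $m_{\theta,i}$ being the multiplicity of $V_{\theta,i}$), and let $m_{\theta,i}V_{\theta,i}=V^1_{\theta,i}\oplus\cdots\oplus V^{m_{\theta,i}}_{\theta,i}$ be an orthogonal decomposition of the isotypic block $m_{\theta,i}V_{\theta,i}$ with each $V^j_{\theta,i}$ equivalent to $V_{\theta,i}$. Let $S_\theta\ni 1_G$ be a system of representatives for the left cosets of $G_\theta$ in $G$ and set \[ W^j_{\theta,i}=\bigoplus_{s\in S_\theta}\{\chi_{s\theta}\otimes f:f\in sV^j_{\theta,i}\},\qquad m_{\theta,i}W_{\theta,i}=W^1_{\theta,i}\oplus\cdots\oplus W^{m_{\theta,i}}_{\theta,i}. \] Then \[ L(C_2^Z\times X)=\bigoplus_{\theta\in\Theta}\bigoplus_{i=0}^{n(\theta)}m_{\theta,i}W_{\theta,i} \] is the decomposition of $L(C_2^Z\times X)$ into irreducible $C_2\wr G$-representations, and $m_{\theta,i}W_{\theta,i}=W^1_{\theta,i}\oplus\cdots\oplus W^{m_{\theta,i}}_{\theta,i}$ is an orthogonal decomposition of the isotypic block $m_{\theta,i}W_{\theta,i}$ (so the $W^j_{\theta,i}$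 are irreducible, and $W^j_{\theta,i}$, $W^{j'}_{\theta',i'}$ are equivalent if and only if $(\theta,i)=(\theta',i')$).
   Context: $C_2=\{0,1\}$ with addition mod $2$; $C_2^Z$ is the group of functions $Z\to C_2$. A homogeneous $G$-space is a set with a transitive $G$-action. $G$ acts on $C_2^Z$ by $(g\omega)(z)=\omega(g^{-1}z)$. The wreath product $C_2\wr G$ is the set $C_2^Z\times G$ with product $(\theta,g)(\omega,h)=(\theta+g\omega,gh)$. It acts on $C_2^Z\times X$ by $(\omega,g)(\theta,x)=(\omega+g\theta,gx)$. For $\theta\in C_2^Z$, $G_\theta=\{g\in G:g\theta=\theta\}$, and $\chi_\theta(\omega)=(-1)^{\sum_{z\in Z}\theta(z)\omega(z)}$. For a finite set $Y$, $L(Y)$ is the space of complex functions on $Y$ with scalar product $\sum_y f_1(y)\overline{f_2(y)}$; if a group acts on $Y$ it acts on $L(Y)$ by $(gf)(y)=f(g^{-1}y)$ (permutation representation). For $F\in L(C_2^Z)$, $f\in L(X)$, $(F\otimes f)(\omega,x)=F(\omega)f(x)$. For a subspace $V\subseteq L(X)$, $sV=\{sf:f\in V\}$. *)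

theory Defs
  imports
    "HOL-Analysis.Analysis"
    "HOL-Algebra.Group_Action"
    "HOL-Algebra.Left_Coset"
    "HOL-Library.Z2"
begin

section \<open>The function spaces L(Y)\<close>

text \<open>
  A finite nonempty set \<open>Y\<close> is a type \<open>'y\<close> of class \<open>finite\<close>, and \<open>L(Y)\<close> is
  \<open>complex ^ 'y\<close>, a complex vector space under \<open>(*s)\<close>; \<open>f $ y\<close> is the value \<open>f(y)\<close>.
  The inner product that the library puts on \<open>complex ^ 'y\<close> is only the real part of the
  Hermitian scalar product below.
\<close>

definition L_inner :: "complex ^ 'y::finite \<Rightarrow> complex ^ 'y \<Rightarrow> complex" where
  "L_inner f1 f2 = (\<Sum>y\<in>UNIV. f1 $ y * cnj (f2 $ y))"

definition L_orthogonal :: "(complex ^ 'y::finite) set \<Rightarrow> (complex ^ 'y) set \<Rightarrow> bool" where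
  "L_orthogonal A B \<longleftrightarrow> (\<forall>f1\<in>A. \<forall>f2\<in>B. L_inner f1 f2 = 0)"

definition subspace_sum :: "'i set \<Rightarrow> ('i \<Rightarrow> (complex ^ 'y::finite) set) \<Rightarrow> (complex ^ 'y) set" where
  "subspace_sum I A = {\<Sum>i\<in>I. v i |v. \<forall>i\<in>I. v i \<in> A i}"

definition is_direct_sum ::
    "'i set \<Rightarrow> ('i \<Rightarrow> (complex ^ 'y::finite) set) \<Rightarrow> (complex ^ 'y) set \<Rightarrow> bool" where
  "is_direct_sum I A U \<longleftrightarrow>
     finite I \<and> (\<forall>i\<in>I. vec.subspace (A i)) \<and> U = subspace_sum I A \<and>
     (\<forall>v. (\<forall>i\<in>I. v i \<in> A i) \<longrightarrow> (\<Sum>i\<in>I. v i) = 0 \<longrightarrow> (\<forall>i\<in>I. v i = 0))"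

definition is_orthogonal_sum ::
    "'i set \<Rightarrow> ('i \<Rightarrow> (complex ^ 'y::finite) set) \<Rightarrow> (complex ^ 'y) set \<Rightarrow> bool" where
  "is_orthogonal_sum I A U \<longleftrightarrow>
     is_direct_sum I A U \<and> (\<forall>i\<in>I. \<forall>j\<in>I. i \<noteq> j \<longrightarrow> L_orthogonal (A i) (A j))"


section \<open>Representations on L(Y)\<close>

definition perm_rep ::
    "('h, 'm) monoid_scheme \<Rightarrow> ('h \<Rightarrow> 'y \<Rightarrow> 'y) \<Rightarrow> 'h \<Rightarrow> complex ^ 'y::finite \<Rightarrow> complex ^ 'y" where
  "perm_rep H \<alpha> g f = (\<chi> y. f $ \<alpha> (inv\<^bsub>H\<^esub> g) y)"

text \<open>
  Below, \<open>\<rho>\<close> is a linear representation on \<open>L(Y)\<close> and \<open>H\<close> the group acting through it.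
  The restriction to a subgroup \<open>K\<close> is obtained with \<open>H\<lparr>carrier := K\<rparr>\<close> in place of \<open>H\<close>.
\<close>

definition subrep ::
    "('h, 'm) monoid_scheme \<Rightarrow> ('h \<Rightarrow> complex ^ 'y::finite \<Rightarrow> complex ^ 'y) \<Rightarrow>
     (complex ^ 'y) set \<Rightarrow> bool" where
  "subrep H \<rho> A \<longleftrightarrow> vec.subspace A \<and> (\<forall>h\<in>carrier H. \<forall>f\<in>A. \<rho> h f \<in> A)"

definition irreducible_subrep ::
    "('h, 'm) monoid_scheme \<Rightarrow> ('h \<Rightarrow> complex ^ 'y::finite \<Rightarrow> complex ^ 'y) \<Rightarrow>
     (complex ^ 'y) set \<Rightarrow> bool" where
  "irreducible_subrep H \<rho> A \<longleftrightarrow>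
     subrep H \<rho> A \<and> A \<noteq> {0} \<and> (\<forall>B. subrep H \<rho> B \<and> B \<subseteq> A \<longrightarrow> B = {0} \<or> B = A)"

definition equivalent_subreps ::
    "('h, 'm) monoid_scheme \<Rightarrow> ('h \<Rightarrow> complex ^ 'y::finite \<Rightarrow> complex ^ 'y) \<Rightarrow>
     (complex ^ 'y) set \<Rightarrow> (complex ^ 'y) set \<Rightarrow> bool" where
  "equivalent_subreps H \<rho> A B \<longleftrightarrow>
     (\<exists>T. bij_betw T A B \<and>
          (\<forall>f1\<in>A. \<forall>f2\<in>A. T (f1 + f2) = T f1 + T f2) \<and>
          (\<forall>c. \<forall>f\<in>A. T (c *s f) = c *s T f) \<and>
          (\<forall>h\<in>carrier H. \<forall>f\<in>A. T (\<rho> h f) = \<rho> h (T f)))"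

text \<open>The sum of all subrepresentations of \<open>U\<close> equivalent to \<open>A\<close> (for \<open>A\<close> irreducible).\<close>

definition isotypic_component ::
    "('h, 'm) monoid_scheme \<Rightarrow> ('h \<Rightarrow> complex ^ 'y::finite \<Rightarrow> complex ^ 'y) \<Rightarrow>
     (complex ^ 'y) set \<Rightarrow> (complex ^ 'y) set \<Rightarrow> (complex ^ 'y) set" where
  "isotypic_component H \<rho> U A =
     vec.span (\<Union>{B. subrep H \<rho> B \<and> B \<subseteq> U \<and> equivalent_subreps H \<rho> B A})"

text \<open>
  The decomposition \<open>U = \<Oplus>\<^sub>i m\<^sub>i V\<^sub>i\<close> into irreducible representations, the \<open>V\<^sub>i\<close> being
  pairwise inequivalent and occurring with multiplicity \<open>m\<^sub>i > 0\<close>, together with an orthogonal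
  decomposition \<open>m\<^sub>i V\<^sub>i = V i 1 \<oplus> \<dots> \<oplus> V i (m i)\<close> of each isotypic block. The \<open>V\<^sub>i\<close>
  themselves are determined up to equivalence only: \<open>V\<^sub>i\<close> is the class of the \<open>V i j\<close>.
\<close>

definition isotypic_decomposition ::
    "('h, 'm) monoid_scheme \<Rightarrow> ('h \<Rightarrow> complex ^ 'y::finite \<Rightarrow> complex ^ 'y) \<Rightarrow>
     (complex ^ 'y) set \<Rightarrow> 'i set \<Rightarrow> ('i \<Rightarrow> nat) \<Rightarrow> ('i \<Rightarrow> nat \<Rightarrow> (complex ^ 'y) set) \<Rightarrow> bool" where
  "isotypic_decomposition H \<rho> U I m V \<longleftrightarrow>
     is_direct_sum I (\<lambda>i. subspace_sum {1..m i} (V i)) U \<and>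
     (\<forall>i\<in>I. 0 < m i) \<and>
     (\<forall>i\<in>I. \<forall>j\<in>{1..m i}. irreducible_subrep H \<rho> (V i j)) \<and>
     (\<forall>i\<in>I. \<forall>j\<in>{1..m i}. \<forall>i'\<in>I. \<forall>j'\<in>{1..m i'}.
        equivalent_subreps H \<rho> (V i j) (V i' j') \<longleftrightarrow> i = i') \<and>
     (\<forall>i\<in>I. \<forall>j\<in>{1..m i}.
        is_orthogonal_sum {1..m i} (V i) (isotypic_component H \<rho> U (V i j)))"


section \<open>The wreath product of C2 with G and its action\<close>

instance bit :: finite
proof
  have "(UNIV :: bit set) = {0, 1}"
    using bit_not_zero_iff by blast
  then show "finite (UNIV :: bit set)"
    by (metis finite.emptyI finite.insertI)
qed

text \<open>
  \<open>C2\<close> is the library type \<open>bit\<close>, and the group of functions from \<open>Z\<close> to \<open>C2\<close> is \<open>'z \<Rightarrow> bit\<close>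
  under pointwise addition. \<open>\<phi>\<close> is the action of \<open>G\<close> on \<open>Z\<close>, \<open>\<psi>\<close> the action on \<open>X\<close>.
\<close>

definition config_act ::
    "('g, 'm) monoid_scheme \<Rightarrow> ('g \<Rightarrow> 'z \<Rightarrow> 'z) \<Rightarrow> 'g \<Rightarrow> ('z \<Rightarrow> bit) \<Rightarrow> ('z \<Rightarrow> bit)" where
  "config_act G \<phi> g \<omega> = (\<lambda>z. \<omega> (\<phi> (inv\<^bsub>G\<^esub> g) z))"

definition C2_wreath ::
    "('g, 'm) monoid_scheme \<Rightarrow> ('g \<Rightarrow> 'z \<Rightarrow> 'z) \<Rightarrow> (('z \<Rightarrow> bit) \<times> 'g) monoid" where
  "C2_wreath G \<phi> =
     \<lparr>carrier = UNIV \<times> carrier G,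
      mult = (\<lambda>(\<theta>, g) (\<omega>, h). ((\<lambda>z. \<theta> z + config_act G \<phi> g \<omega> z), g \<otimes>\<^bsub>G\<^esub> h)),
      one = ((\<lambda>z. 0), \<one>\<^bsub>G\<^esub>)\<rparr>"

definition wreath_act ::
    "('g, 'm) monoid_scheme \<Rightarrow> ('g \<Rightarrow> 'z \<Rightarrow> 'z) \<Rightarrow> ('g \<Rightarrow> 'x \<Rightarrow> 'x) \<Rightarrow>
     ('z \<Rightarrow> bit) \<times> 'g \<Rightarrow> ('z \<Rightarrow> bit) \<times> 'x \<Rightarrow> ('z \<Rightarrow> bit) \<times> 'x" where
  "wreath_act G \<phi> \<psi> = (\<lambda>(\<omega>, g) (\<theta>, x). ((\<lambda>z. \<omega> z + config_act G \<phi> g \<theta> z), \<psi> g x))"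

definition config_char :: "('z::finite \<Rightarrow> bit) \<Rightarrow> complex ^ ('z \<Rightarrow> bit)" where
  "config_char \<theta> = (\<chi> \<omega>. (-1) ^ (\<Sum>z\<in>UNIV. of_bool (\<theta> z * \<omega> z = 1)))"

definition L_tensor ::
    "complex ^ ('z::finite \<Rightarrow> bit) \<Rightarrow> complex ^ 'x::finite \<Rightarrow> complex ^ (('z \<Rightarrow> bit) \<times> 'x)" where
  "L_tensor F f = (\<chi> p. F $ fst p * f $ snd p)"

definition system_of_representatives :: "'a set \<Rightarrow> 'a set set \<Rightarrow> bool" where
  "system_of_representatives R P \<longleftrightarrow> R \<subseteq> \<Union>P \<and> (\<forall>C\<in>P. \<exists>!r. r \<in> R \<inter> C)"

definition stab_group ::
    "('g, 'm) monoid_scheme \<Rightarrow> ('g \<Rightarrow> 'z \<Rightarrow> 'z) \<Rightarrow> ('z \<Rightarrow> bit) \<Rightarrow> ('g, 'm) monoid_scheme" where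
  "stab_group G \<phi> \<theta> = G\<lparr>carrier := stabilizer G (config_act G \<phi>) \<theta>\<rparr>"

text \<open>
  The space \<open>{\<chi>\<^sub>s\<^sub>\<theta> \<otimes> f : f \<in> s A}\<close>, and the sum of these spaces over \<open>s \<in> S\<close>.
  That this sum is direct is part of the theorem.
\<close>

definition W_summand ::
    "('g, 'm) monoid_scheme \<Rightarrow> ('g \<Rightarrow> 'z \<Rightarrow> 'z) \<Rightarrow> ('g \<Rightarrow> 'x \<Rightarrow> 'x) \<Rightarrow>
     ('z::finite \<Rightarrow> bit) \<Rightarrow> (complex ^ 'x::finite) set \<Rightarrow> 'g \<Rightarrow>
     (complex ^ (('z \<Rightarrow> bit) \<times> 'x)) set" where
  "W_summand G \<phi> \<psi> \<theta> A s =
     {L_tensor (config_char (config_act G \<phi> s \<theta>)) f |f. f \<in> perm_rep G \<psi> s ` A}"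

definition W_space ::
    "('g, 'm) monoid_scheme \<Rightarrow> ('g \<Rightarrow> 'z \<Rightarrow> 'z) \<Rightarrow> ('g \<Rightarrow> 'x \<Rightarrow> 'x) \<Rightarrow>
     'g set \<Rightarrow> ('z::finite \<Rightarrow> bit) \<Rightarrow> (complex ^ 'x::finite) set \<Rightarrow>
     (complex ^ (('z \<Rightarrow> bit) \<times> 'x)) set" where
  "W_space G \<phi> \<psi> S \<theta> A = subspace_sum S (W_summand G \<phi> \<psi> \<theta> A)"

end

theory Submission
  imports Defs
begin

text \<open>
  Decompose a function on configurations times \<open>X\<close> into its Fourier coefficients, one element
  of \<open>L(X)\<close> for each character \<open>\<chi>\<^sub>\<eta>\<close>. The base group of the wreath product acts on the
  \<open>\<eta>\<close>-component by the scalars \<open>\<chi>\<^sub>\<eta>(\<omega>)\<close>, so averaging against \<open>\<chi>\<^sub>\<eta>\<close> projects every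
  subrepresentation onto its \<open>\<eta>\<close>-component, whereas \<open>G\<close> permutes the components along the
  orbits of configurations. Hence a subrepresentation supported on the orbit of \<open>\<theta>\<close> is determined
  by its fiber over \<open>\<theta>\<close>, which is an arbitrary \<open>G\<^sub>\<theta>\<close>-subrepresentation of \<open>L(X)\<close>; the inverse
  of taking fibers is induction, and the spaces \<open>W\<close> of the theorem are the induced ones. Both
  directions preserve inclusions, equivalence, direct sums and orthogonality, which transports the
  decompositions of \<open>L(X)\<close> under the stabilizers to the wreath product.
\<close>

section \<open>Subspaces and representations of L(Y)\<close>

lemma subspace_sum_subspace:
  assumes "\<And>i. i \<in> I \<Longrightarrow> vec.subspace (A i)"
  shows "vec.subspace (subspace_sum I A)"
proof (rule vec.subspaceI)
  show "0 \<in> subspace_sum I A"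
    unfolding subspace_sum_def
    by (rule CollectI, rule exI[of _ "\<lambda>_. 0"]) (simp add: assms vec.subspace_0)
next
  fix f g assume "f \<in> subspace_sum I A" "g \<in> subspace_sum I A"
  then obtain u v where "f = (\<Sum>i\<in>I. u i)" "\<forall>i\<in>I. u i \<in> A i"
      "g = (\<Sum>i\<in>I. v i)" "\<forall>i\<in>I. v i \<in> A i"
    by (auto simp: subspace_sum_def)
  then show "f + g \<in> subspace_sum I A"
    unfolding subspace_sum_def
    by (intro CollectI exI[of _ "\<lambda>i. u i + v i"])
      (simp add: sum.distrib assms vec.subspace_add)
next
  fix c f assume "f \<in> subspace_sum I A"
  then obtain u where "f = (\<Sum>i\<in>I. u i)" "\<forall>i\<in>I. u i \<in> A i"
    by (auto simp: subspace_sum_def)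
  then show "c *s f \<in> subspace_sum I A"
    unfolding subspace_sum_def
    by (intro CollectI exI[of _ "\<lambda>i. c *s u i"])
      (simp add: vec.scale_sum_right assms vec.subspace_scale)
qed

lemma subspace_sum_cong:
  "(\<And>i. i \<in> I \<Longrightarrow> A i = B i) \<Longrightarrow> subspace_sum I A = subspace_sum I B"
  unfolding subspace_sum_def by (metis (no_types, lifting))

lemma is_direct_sum_cong:
  "(\<And>i. i \<in> I \<Longrightarrow> A i = B i) \<Longrightarrow> is_direct_sum I A U \<longleftrightarrow> is_direct_sum I B U"
  unfolding is_direct_sum_def using subspace_sum_cong[of I A B] by auto

lemma subspace_sum_least:
  assumes "vec.subspace U" "\<And>i. i \<in> I \<Longrightarrow> A i \<subseteq> U"
  shows "subspace_sum I A \<subseteq> U"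
  using assms by (force simp: subspace_sum_def intro!: vec.subspace_sum)

lemma subspace_sum_upper:
  assumes "finite I" "i \<in> I" "\<And>i. i \<in> I \<Longrightarrow> vec.subspace (A i)"
  shows "A i \<subseteq> subspace_sum I A"
proof
  fix f assume "f \<in> A i"
  then show "f \<in> subspace_sum I A"
    unfolding subspace_sum_def
    using assms
    by (intro CollectI exI[of _ "\<lambda>j. if j = i then f else 0"]) (auto simp: vec.subspace_0)
qed

lemma is_direct_sum_independentD:
  assumes "is_direct_sum I A U" "\<And>i. i \<in> I \<Longrightarrow> v i \<in> A i" "(\<Sum>i\<in>I. v i) = 0" "i \<in> I"
  shows "v i = 0"
  using assms unfolding is_direct_sum_def by blast

section \<open>Linearity of permutation representations, and invariant subspaces\<close>

lemma perm_rep_add: "perm_rep H \<alpha> h (f + g) = perm_rep H \<alpha> h f + perm_rep H \<alpha> h g"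
  by (simp add: perm_rep_def vec_eq_iff)

lemma perm_rep_scale: "perm_rep H \<alpha> h (c *s f) = c *s perm_rep H \<alpha> h f"
  by (simp add: perm_rep_def vec_eq_iff)

lemma perm_rep_zero [simp]: "perm_rep H \<alpha> h 0 = 0"
  by (simp add: perm_rep_def vec_eq_iff)

lemma perm_rep_sum: "perm_rep H \<alpha> h (\<Sum>i\<in>I. f i) = (\<Sum>i\<in>I. perm_rep H \<alpha> h (f i))"
  by (induction I rule: infinite_finite_induct) (simp_all add: perm_rep_add)

lemma subrep_subspace: "subrep H \<rho> A \<Longrightarrow> vec.subspace A"
  by (simp add: subrep_def)

text \<open>\<open>H\<close> is the group whose elements act, \<open>H'\<close> the group that
  defines the permutation representation. They are kept apart because a stabilizer acts on
  \<open>L(X)\<close> through the representation of all of \<open>G\<close>.\<close>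

lemma subrep_closed:
  "subrep H (perm_rep H' \<alpha>) A \<Longrightarrow> h \<in> carrier H \<Longrightarrow> f \<in> A \<Longrightarrow> perm_rep H' \<alpha> h f \<in> A"
  by (simp add: subrep_def)

lemma subrep_span:
  assumes "\<And>B. B \<in> \<B> \<Longrightarrow> subrep H (perm_rep H' \<alpha>) B"
  shows "subrep H (perm_rep H' \<alpha>) (vec.span (\<Union>\<B>))"
  unfolding subrep_def
proof (intro conjI ballI)
  fix h f assume h: "h \<in> carrier H" and f: "f \<in> vec.span (\<Union>\<B>)"
  show "perm_rep H' \<alpha> h f \<in> vec.span (\<Union>\<B>)"
    using f
  proof (induction rule: vec.span_induct_alt)
    case base
    then show ?case by (simp add: vec.span_zero)
  next
    case (step c x y)
    then have "perm_rep H' \<alpha> h x \<in> \<Union>\<B>"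
      using assms h by (auto dest: subrep_closed)
    then show ?case
      by (simp add: perm_rep_add perm_rep_scale step vec.span_add vec.span_scale vec.span_base)
  qed
qed simp

lemma isotypic_component_upper:
  assumes "subrep H \<rho> B" "B \<subseteq> U" "equivalent_subreps H \<rho> B A"
  shows "B \<subseteq> isotypic_component H \<rho> U A"
proof -
  have "B \<subseteq> \<Union>{B. subrep H \<rho> B \<and> B \<subseteq> U \<and> equivalent_subreps H \<rho> B A}"
    using assms by (intro Union_upper) simp
  then show ?thesis
    unfolding isotypic_component_def using vec.span_superset by (rule subset_trans)
qed

lemma subrep_isotypic_component:
  "subrep H (perm_rep H' \<alpha>) (isotypic_component H (perm_rep H' \<alpha>) U A)"
  unfolding isotypic_component_def by (rule subrep_span) blast

lemma subrep_subspace_sum: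
  assumes "\<And>i. i \<in> I \<Longrightarrow> subrep H (perm_rep H' \<alpha>) (A i)"
  shows "subrep H (perm_rep H' \<alpha>) (subspace_sum I A)"
  unfolding subrep_def
proof (intro conjI ballI)
  show "vec.subspace (subspace_sum I A)"
    using assms by (intro subspace_sum_subspace) (rule subrep_subspace)
  fix h f assume h: "h \<in> carrier H" and "f \<in> subspace_sum I A"
  then obtain u where "f = (\<Sum>i\<in>I. u i)" "\<forall>i\<in>I. u i \<in> A i"
    by (auto simp: subspace_sum_def)
  then show "perm_rep H' \<alpha> h f \<in> subspace_sum I A"
    unfolding subspace_sum_def
    using subrep_closed[OF assms h]
    by (intro CollectI exI[of _ "\<lambda>i. perm_rep H' \<alpha> h (u i)"]) (auto simp: perm_rep_sum)
qed

text \<open>An intertwiner is bijective and sends \<open>0\<close> to \<open>0\<close>, by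
  homogeneity with scalar \<open>0\<close>. Applied to fibers, this shows that equivalent
  subrepresentations are supported on the same characters.\<close>

lemma equivalent_subreps_zero_iff:
  assumes "equivalent_subreps H \<rho> A B" "vec.subspace A" "vec.subspace B"
  shows "A = {0} \<longleftrightarrow> B = {0}"
proof -
  obtain T where T: "bij_betw T A B" "\<And>c f. f \<in> A \<Longrightarrow> T (c *s f) = c *s T f"
    using assms(1) by (auto simp: equivalent_subreps_def)
  have 0: "0 \<in> A" using assms(2) by (rule vec.subspace_0)
  have "T 0 = 0" using T(2)[of 0 0] 0 by simp
  have inj: "f = 0" if "f \<in> A" "T f = 0" for f
    using T(1) 0 that \<open>T 0 = 0\<close> unfolding bij_betw_def by (metis inj_onD)
  have im: "B = T ` A"
    using T(1) by (simp add: bij_betw_def)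
  show ?thesis
  proof
    assume "A = {0}"
    then show "B = {0}" using im \<open>T 0 = 0\<close> by simp
  next
    assume "B = {0}"
    then have "f = 0" if "f \<in> A" for f
      using im that inj[OF that] by blast
    then show "A = {0}" using 0 by blast
  qed
qed

section \<open>Fourier analysis on the configuration space\<close>

text \<open>Turning the exponent into a product over the points of \<open>Z\<close> reduces
  multiplicativity, symmetry and the square to statements about single values in
  \<open>C2\<close>.\<close>

lemma config_char_prod:
  "config_char \<eta> $ \<omega> = (\<Prod>z\<in>UNIV. (-1) ^ of_bool (\<eta> z * \<omega> z = 1))"
  unfolding config_char_def vec_lambda_beta power_sum ..

lemma config_char_add:
  "config_char \<eta> $ (\<lambda>z. \<omega> z + \<tau> z) = config_char \<eta> $ \<omega> * config_char \<eta> $ \<tau>"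
proof -
  have "(-1::complex) ^ of_bool (a * (b + c) = 1) = (-1) ^ of_bool (a * b = 1) * (-1) ^ of_bool (a * c = 1)"
    for a b c :: bit
    by (cases a; cases b; cases c) simp_all
  then show ?thesis
    by (simp add: config_char_prod prod.distrib)
qed

text \<open>The pairing of configurations is symmetric. Hence orthogonality, summed over the group,
  serves equally as orthogonality summed over the characters, which inversion requires.\<close>

lemma config_char_sym: "config_char \<eta> $ \<omega> = config_char \<omega> $ \<eta>"
  unfolding config_char_prod by (subst mult.commute) rule

lemma config_char_square: "config_char \<eta> $ \<omega> * config_char \<eta> $ \<omega> = 1"
proof -
  have "(-1::complex) ^ of_bool b * (-1) ^ of_bool b = 1" for b by (cases b) simp_all
  then show ?thesis
    by (simp add: config_char_prod flip: prod.distrib)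
qed

lemma config_char_cnj [simp]: "cnj (config_char \<eta> $ \<omega>) = config_char \<eta> $ \<omega>"
  by (simp add: config_char_def)

lemma bij_config_translate: "bij (\<lambda>\<tau> z. \<omega> z + \<tau> z :: bit)"
proof (rule involuntory_imp_bij)
  fix \<tau> :: "'a \<Rightarrow> bit"
  have "a + (a + b) = b" for a b :: bit by (cases a; cases b) simp_all
  then show "(\<lambda>z. \<omega> z + (\<omega> z + \<tau> z)) = \<tau>" by simp
qed

text \<open>A sum over configurations is unchanged by translation by a point where the two characters differ,
  while its terms change sign.\<close>

lemma config_char_orthogonal:
  "(\<Sum>\<omega>\<in>UNIV. config_char \<eta> $ \<omega> * config_char \<zeta> $ \<omega>)
     = (if \<eta> = \<zeta> then of_nat CARD('z \<Rightarrow> bit) else 0)"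
  for \<eta> \<zeta> :: "'z::finite \<Rightarrow> bit"
proof (cases "\<eta> = \<zeta>")
  case True
  then show ?thesis by (simp add: config_char_square)
next
  case False
  then obtain z where z: "\<eta> z \<noteq> \<zeta> z" by blast
  define e :: "'z \<Rightarrow> bit" where "e = (\<lambda>w. of_bool (w = z))"
  have char_e: "config_char \<theta> $ e = (-1) ^ of_bool (\<theta> z = 1)" for \<theta>
  proof -
    have "config_char \<theta> $ e = (\<Prod>w\<in>UNIV. if w = z then (-1) ^ of_bool (\<theta> z = 1) else 1)"
      unfolding config_char_prod by (rule prod.cong) (auto simp: e_def)
    then show ?thesis by simp
  qed
  have sgn: "config_char \<eta> $ e * config_char \<zeta> $ e = -1"
    using z unfolding char_e by (cases "\<eta> z"; cases "\<zeta> z") simp_all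
  let ?s = "\<Sum>\<omega>\<in>UNIV. config_char \<eta> $ \<omega> * config_char \<zeta> $ \<omega>"
  have "?s = (\<Sum>\<omega>\<in>UNIV. config_char \<eta> $ (\<lambda>w. e w + \<omega> w) * config_char \<zeta> $ (\<lambda>w. e w + \<omega> w))"
    by (rule sum.reindex_bij_betw[OF bij_config_translate[of e],
          of "\<lambda>\<omega>. config_char \<eta> $ \<omega> * config_char \<zeta> $ \<omega>", symmetric])
  also have "\<dots> = (\<Sum>\<omega>\<in>UNIV. (config_char \<eta> $ e * config_char \<zeta> $ e)
                     * (config_char \<eta> $ \<omega> * config_char \<zeta> $ \<omega>))"
    by (intro sum.cong refl) (simp only: config_char_add mult_ac)
  also have "\<dots> = - ?s"
    by (simp add: sgn sum_negf)
  finally have "?s + ?s = 0"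
    by (rule eq_neg_iff_add_eq_0[THEN iffD1])
  then show ?thesis
    using False by (simp flip: mult_2)
qed

section \<open>Fourier coefficients in the configuration variable, inversion and Parseval\<close>

lemma L_tensor_nth [simp]: "L_tensor F f $ (\<omega>, x) = F $ \<omega> * f $ x"
  by (simp add: L_tensor_def)

lemma L_tensor_zero [simp]: "L_tensor F 0 = 0"
  by (simp add: L_tensor_def vec_eq_iff)

lemma L_tensor_add: "L_tensor F (f + g) = L_tensor F f + L_tensor F g"
  by (simp add: L_tensor_def vec_eq_iff algebra_simps)

lemma L_tensor_scale: "L_tensor F (c *s f) = c *s L_tensor F f"
  by (simp add: L_tensor_def vec_eq_iff)

text \<open>The transform in the configuration variable alone, with values in \<open>L(X)\<close>.
  No conjugate appears because the characters are real, and the normalization makes \<open>f\<close>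
  the coefficient of \<open>L_tensor (config_char \<eta>) f\<close>.\<close>

definition fourier_coeff ::
    "('z::finite \<Rightarrow> bit) \<Rightarrow> complex ^ (('z \<Rightarrow> bit) \<times> 'x::finite) \<Rightarrow> complex ^ 'x" where
  "fourier_coeff \<eta> F =
     (\<chi> x. (\<Sum>\<omega>\<in>UNIV. config_char \<eta> $ \<omega> * F $ (\<omega>, x)) / of_nat CARD('z \<Rightarrow> bit))"

lemma fourier_coeff_add: "fourier_coeff \<eta> (F + F') = fourier_coeff \<eta> F + fourier_coeff \<eta> F'"
  by (simp add: fourier_coeff_def vec_eq_iff algebra_simps sum.distrib add_divide_distrib)

lemma fourier_coeff_scale: "fourier_coeff \<eta> (c *s F) = c *s fourier_coeff \<eta> F"
  by (simp add: fourier_coeff_def vec_eq_iff sum_distrib_left mult_ac)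

lemma fourier_coeff_zero [simp]: "fourier_coeff \<eta> 0 = 0"
  by (simp add: fourier_coeff_def vec_eq_iff)

lemma fourier_coeff_sum: "fourier_coeff \<eta> (\<Sum>i\<in>I. F i) = (\<Sum>i\<in>I. fourier_coeff \<eta> (F i))"
  by (induction I rule: infinite_finite_induct) (simp_all add: fourier_coeff_add)

lemma fourier_coeff_tensor:
  "fourier_coeff \<eta> (L_tensor (config_char \<zeta>) f) = (if \<eta> = \<zeta> then f else 0)"
  unfolding vec_eq_iff fourier_coeff_def vec_lambda_beta L_tensor_nth mult.assoc[symmetric]
    sum_distrib_right[symmetric] config_char_orthogonal
  by simp

text \<open>After exchanging the sums and swapping index and argument by
  \<open>config_char_sym\<close>, the sum over all characters is the delta function at
  \<open>\<tau>\<close> times the group order, which the normalization cancels.\<close>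

lemma fourier_inversion:
  fixes F :: "complex ^ (('z::finite \<Rightarrow> bit) \<times> 'x::finite)"
  shows "(\<Sum>\<eta>\<in>UNIV. L_tensor (config_char \<eta>) (fourier_coeff \<eta> F)) = F"
proof -
  have "(\<Sum>\<eta>\<in>UNIV. L_tensor (config_char \<eta>) (fourier_coeff \<eta> F)) $ (\<tau>, x) = F $ (\<tau>, x)" for \<tau> x
  proof -
    let ?N = "of_nat CARD('z \<Rightarrow> bit) :: complex"
    have "(\<Sum>\<eta>\<in>UNIV. L_tensor (config_char \<eta>) (fourier_coeff \<eta> F)) $ (\<tau>, x)
        = (\<Sum>\<eta>\<in>UNIV. \<Sum>\<omega>\<in>UNIV. (config_char \<tau> $ \<eta> * config_char \<omega> $ \<eta>) * (F $ (\<omega>, x) / ?N))"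
      unfolding sum_component L_tensor_nth fourier_coeff_def vec_lambda_beta sum_divide_distrib
        sum_distrib_left
    proof (intro sum.cong refl)
      fix \<eta> \<omega>
      show "config_char \<eta> $ \<tau> * (config_char \<eta> $ \<omega> * F $ (\<omega>, x) / ?N)
          = config_char \<tau> $ \<eta> * config_char \<omega> $ \<eta> * (F $ (\<omega>, x) / ?N)"
        unfolding config_char_sym[of \<eta> \<tau>] config_char_sym[of \<eta> \<omega>] by simp
    qed
    also have "\<dots> = (\<Sum>\<omega>\<in>UNIV. (\<Sum>\<eta>\<in>UNIV. config_char \<tau> $ \<eta> * config_char \<omega> $ \<eta>) * (F $ (\<omega>, x) / ?N))"
      unfolding sum_distrib_right by (rule sum.swap)
    also have "\<dots> = (\<Sum>\<omega>\<in>UNIV. if \<tau> = \<omega> then F $ (\<omega>, x) else 0)"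
      unfolding config_char_orthogonal by (intro sum.cong) simp_all
    finally show ?thesis by simp
  qed
  then show ?thesis
    unfolding vec_eq_iff split_paired_All by blast
qed

lemma fourier_eqI:
  assumes "\<And>\<eta>. fourier_coeff \<eta> F = fourier_coeff \<eta> F'"
  shows "F = F'"
  using fourier_inversion[of F] unfolding assms by (simp add: fourier_inversion)

lemma fourier_coeff_synthesis:
  "fourier_coeff \<eta> (\<Sum>\<zeta>\<in>UNIV. L_tensor (config_char \<zeta>) (c \<zeta>)) = c \<eta>"
  by (simp add: fourier_coeff_sum fourier_coeff_tensor)

text \<open>Only \<open>F\<close> is expanded by inversion; summing the characters against the
  conjugate of \<open>F'\<close> then rebuilds the coefficients of \<open>F'\<close>. The factor is
  the squared norm of a character.\<close>

lemma L_inner_parseval: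
  fixes F F' :: "complex ^ (('z::finite \<Rightarrow> bit) \<times> 'x::finite)"
  shows "L_inner F F' = of_nat CARD('z \<Rightarrow> bit)
    * (\<Sum>\<eta>\<in>UNIV. L_inner (fourier_coeff \<eta> F) (fourier_coeff \<eta> F'))"
proof -
  let ?N = "of_nat CARD('z \<Rightarrow> bit) :: complex"
  have F: "F $ (\<omega>, x) = (\<Sum>\<eta>\<in>UNIV. config_char \<eta> $ \<omega> * fourier_coeff \<eta> F $ x)" for \<omega> x
    by (subst fourier_inversion[of F, symmetric]) (simp add: sum_component)
  have "L_inner F F' = (\<Sum>x\<in>UNIV. \<Sum>\<omega>\<in>UNIV. F $ (\<omega>, x) * cnj (F' $ (\<omega>, x)))"
    unfolding L_inner_def
    by (subst sum.swap) (simp only: sum.cartesian_product UNIV_Times_UNIV case_prod_unfold prod.collapse)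
  also have "\<dots> = (\<Sum>x\<in>UNIV. \<Sum>\<omega>\<in>UNIV. \<Sum>\<eta>\<in>UNIV. config_char \<eta> $ \<omega> * fourier_coeff \<eta> F $ x * cnj (F' $ (\<omega>, x)))"
    by (simp add: F sum_distrib_right)
  also have "\<dots> = (\<Sum>x\<in>UNIV. \<Sum>\<eta>\<in>UNIV. \<Sum>\<omega>\<in>UNIV. config_char \<eta> $ \<omega> * fourier_coeff \<eta> F $ x * cnj (F' $ (\<omega>, x)))"
    by (intro sum.cong refl sum.swap)
  also have "\<dots> = (\<Sum>x\<in>UNIV. \<Sum>\<eta>\<in>UNIV. ?N * (fourier_coeff \<eta> F $ x * cnj (fourier_coeff \<eta> F' $ x)))"
  proof (intro sum.cong refl)
    fix x \<eta>
    have "cnj (fourier_coeff \<eta> F' $ x) * ?N = (\<Sum>\<omega>\<in>UNIV. config_char \<eta> $ \<omega> * cnj (F' $ (\<omega>, x)))"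
      by (simp add: fourier_coeff_def)
    then have "?N * (fourier_coeff \<eta> F $ x * cnj (fourier_coeff \<eta> F' $ x))
        = fourier_coeff \<eta> F $ x * (\<Sum>\<omega>\<in>UNIV. config_char \<eta> $ \<omega> * cnj (F' $ (\<omega>, x)))"
      by (metis mult.assoc mult.commute)
    then show "(\<Sum>\<omega>\<in>UNIV. config_char \<eta> $ \<omega> * fourier_coeff \<eta> F $ x * cnj (F' $ (\<omega>, x)))
        = ?N * (fourier_coeff \<eta> F $ x * cnj (fourier_coeff \<eta> F' $ x))"
      unfolding sum_distrib_left by (simp only: mult_ac)
  qed
  also have "\<dots> = (\<Sum>\<eta>\<in>UNIV. \<Sum>x\<in>UNIV. ?N * (fourier_coeff \<eta> F $ x * cnj (fourier_coeff \<eta> F' $ x)))"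
    by (rule sum.swap)
  finally show ?thesis
    by (simp add: L_inner_def sum_distrib_left)
qed

section \<open>The wreath product\<close>

locale wreath_action =
  group G + Z: group_action G UNIV \<phi> + X: group_action G UNIV \<psi>
  for G :: "('g, 'm) monoid_scheme" (structure)
    and \<phi> :: "'g \<Rightarrow> 'z::finite \<Rightarrow> 'z"
    and \<psi> :: "'g \<Rightarrow> 'x::finite \<Rightarrow> 'x"
begin

abbreviation act :: "'g \<Rightarrow> ('z \<Rightarrow> bit) \<Rightarrow> ('z \<Rightarrow> bit)" where
  "act \<equiv> config_act G \<phi>"

abbreviation base_rep :: "'g \<Rightarrow> complex ^ 'x \<Rightarrow> complex ^ 'x" where
  "base_rep \<equiv> perm_rep G \<psi>"

abbreviation wreath_group :: "(('z \<Rightarrow> bit) \<times> 'g) monoid" where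
  "wreath_group \<equiv> C2_wreath G \<phi>"

abbreviation wreath_rep ::
    "('z \<Rightarrow> bit) \<times> 'g \<Rightarrow> complex ^ (('z \<Rightarrow> bit) \<times> 'x) \<Rightarrow> complex ^ (('z \<Rightarrow> bit) \<times> 'x)" where
  "wreath_rep \<equiv> perm_rep (C2_wreath G \<phi>) (wreath_act G \<phi> \<psi>)"

section \<open>The actions of \<open>G\<close> on configurations and on \<open>L(X)\<close>\<close>

lemma Z_one: "\<phi> \<one> z = z"
  using Z.id_eq_one by (metis UNIV_I restrict_apply')

lemma X_one: "\<psi> \<one> x = x"
  using X.id_eq_one by (metis UNIV_I restrict_apply')

lemma bij_Z: "g \<in> carrier G \<Longrightarrow> bij (\<phi> g)"
  using Z.bij_prop0 by (simp add: Bij_def)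

lemma bij_X: "g \<in> carrier G \<Longrightarrow> bij (\<psi> g)"
  using X.bij_prop0 by (simp add: Bij_def)

lemma act_one [simp]: "act \<one> \<eta> = \<eta>"
  by (simp add: config_act_def Z_one)

lemma act_mult: "g \<in> carrier G \<Longrightarrow> h \<in> carrier G \<Longrightarrow> act (g \<otimes> h) \<eta> = act g (act h \<eta>)"
  by (simp add: config_act_def inv_mult_group Z.composition_rule)

lemma act_inv_act [simp]: "g \<in> carrier G \<Longrightarrow> act (inv g) (act g \<eta>) = \<eta>"
  by (simp flip: act_mult)

lemma act_act_inv [simp]: "g \<in> carrier G \<Longrightarrow> act g (act (inv g) \<eta>) = \<eta>"
  by (simp flip: act_mult)

lemma act_inv_eq_iff: "g \<in> carrier G \<Longrightarrow> act (inv g) \<zeta> = \<eta> \<longleftrightarrow> \<zeta> = act g \<eta>"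
  by auto

lemma act_add: "act g (\<lambda>z. \<omega> z + \<tau> z) = (\<lambda>z. act g \<omega> z + act g \<tau> z)"
  by (simp add: config_act_def)

lemma bij_act: "g \<in> carrier G \<Longrightarrow> bij (act g)"
  by (rule o_bij[of "act (inv g)"]) (simp_all add: fun_eq_iff)

lemma base_rep_one [simp]: "base_rep \<one> f = f"
  by (simp add: perm_rep_def X_one vec_eq_iff)

lemma base_rep_mult:
  "g \<in> carrier G \<Longrightarrow> h \<in> carrier G \<Longrightarrow> base_rep (g \<otimes> h) f = base_rep g (base_rep h f)"
  by (simp add: perm_rep_def vec_eq_iff inv_mult_group X.composition_rule)

lemma base_rep_inv_rep [simp]: "g \<in> carrier G \<Longrightarrow> base_rep (inv g) (base_rep g f) = f"
  by (simp flip: base_rep_mult)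

lemma base_rep_rep_inv [simp]: "g \<in> carrier G \<Longrightarrow> base_rep g (base_rep (inv g) f) = f"
  by (simp flip: base_rep_mult)

text \<open>\<open>\<psi> (inv g)\<close> permutes \<open>X\<close> and so only reorders the sum.
  This unitarity carries orthogonality from the fiber over \<open>\<theta>\<close> to the rest of
  its orbit.\<close>

lemma L_inner_base_rep:
  assumes "g \<in> carrier G"
  shows "L_inner (base_rep g f) (base_rep g f') = L_inner f f'"
  unfolding L_inner_def perm_rep_def vec_lambda_beta
  by (rule sum.reindex_bij_betw[OF bij_X, of "inv g" "\<lambda>y. f $ y * cnj (f' $ y)"]) (simp add: assms)

text \<open>Reindexing the product over \<open>Z\<close> by \<open>\<phi> g\<close> moves the group
  element from the character to its argument.\<close>

lemma config_char_act:
  assumes "g \<in> carrier G"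
  shows "config_char (act g \<eta>) $ \<omega> = config_char \<eta> $ act (inv g) \<omega>"
proof -
  have "\<phi> (inv g) (\<phi> g w) = w" for w
    using assms Z.orbit_sym_aux by blast
  then have "config_char \<eta> $ act (inv g) \<omega>
      = (\<Prod>w\<in>UNIV. (-1) ^ of_bool (act g \<eta> (\<phi> g w) * \<omega> (\<phi> g w) = 1))"
    using assms unfolding config_char_prod config_act_def by simp
  also have "\<dots> = config_char (act g \<eta>) $ \<omega>"
    unfolding config_char_prod
    by (rule prod.reindex_bij_betw[OF bij_Z[OF assms],
          of "\<lambda>w. (-1) ^ of_bool (act g \<eta> w * \<omega> w = 1)"])
  finally show ?thesis ..
qed

section \<open>Group structure of the wreath product and its action on Fourier coefficients\<close>

lemma carrier_wreath [simp]: "(\<omega>, g) \<in> carrier wreath_group \<longleftrightarrow> g \<in> carrier G"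
  by (simp add: C2_wreath_def)

lemma mult_wreath:
  "(\<omega>, g) \<otimes>\<^bsub>wreath_group\<^esub> (\<tau>, h) = ((\<lambda>z. \<omega> z + act g \<tau> z), g \<otimes> h)"
  by (simp add: C2_wreath_def)

lemma one_wreath: "\<one>\<^bsub>wreath_group\<^esub> = ((\<lambda>z. 0), \<one>)"
  by (simp add: C2_wreath_def)

lemma bit_double: "a + a = 0" for a :: bit
  by (cases a) simp_all

lemma group_wreath: "group wreath_group"
proof (rule groupI)
  fix x y z
  assume "x \<in> carrier wreath_group" "y \<in> carrier wreath_group" "z \<in> carrier wreath_group"
  moreover obtain \<omega> g \<tau> h \<sigma> k where "x = (\<omega>, g)" "y = (\<tau>, h)" "z = (\<sigma>, k)"
    by (metis surj_pair)
  ultimately show "x \<otimes>\<^bsub>wreath_group\<^esub> y \<otimes>\<^bsub>wreath_group\<^esub> z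
      = x \<otimes>\<^bsub>wreath_group\<^esub> (y \<otimes>\<^bsub>wreath_group\<^esub> z)"
    unfolding mult_wreath by (simp only: mult_wreath carrier_wreath act_add act_mult add.assoc m_assoc)
next
  fix x assume "x \<in> carrier wreath_group"
  moreover obtain \<omega> g where "x = (\<omega>, g)" by (metis surj_pair)
  ultimately show "\<exists>y\<in>carrier wreath_group. y \<otimes>\<^bsub>wreath_group\<^esub> x = \<one>\<^bsub>wreath_group\<^esub>"
    \<comment> \<open>A configuration is its own negative, so the inverse carries no sign: two
      copies of \<open>act (inv g) \<omega>\<close> cancel.\<close>
    by (intro bexI[of _ "(act (inv g) \<omega>, inv g)"]) (simp_all only: mult_wreath one_wreath bit_double carrier_wreath l_inv inv_closed)
next
  fix x assume "x \<in> carrier wreath_group"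
  moreover obtain \<omega> g where "x = (\<omega>, g)" by (metis surj_pair)
  ultimately show "\<one>\<^bsub>wreath_group\<^esub> \<otimes>\<^bsub>wreath_group\<^esub> x = x"
    by (simp only: mult_wreath one_wreath act_one add_0 l_one carrier_wreath)
qed (auto simp: mult_wreath one_wreath)

lemma inv_wreath:
  assumes "g \<in> carrier G"
  shows "inv\<^bsub>wreath_group\<^esub> (\<omega>, g) = (act (inv g) \<omega>, inv g)"
  by (rule group.inv_equality[OF group_wreath])
    (use assms in \<open>simp_all only: mult_wreath one_wreath bit_double carrier_wreath l_inv inv_closed\<close>)

lemma wreath_rep_nth:
  assumes "g \<in> carrier G"
  shows "wreath_rep (\<omega>, g) F $ (\<tau>, x) = F $ (act (inv g) (\<lambda>z. \<omega> z + \<tau> z), \<psi> (inv g) x)"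
  unfolding perm_rep_def inv_wreath[OF assms] wreath_act_def act_add by simp

text \<open>Substituting \<open>\<omega> + act g \<tau>\<close> for the summation variable undoes
  the action on the configuration argument of \<open>F\<close>, while the character splits off its
  value at \<open>\<omega>\<close> and takes \<open>g\<close> into its index. Everything later rests
  on this formula: base elements act by scalars, and \<open>G\<close> permutes the
  coefficients.\<close>

lemma fourier_coeff_wreath_rep:
  assumes g: "g \<in> carrier G"
  shows "fourier_coeff \<eta> (wreath_rep (\<omega>, g) F)
    = config_char \<eta> $ \<omega> *s base_rep g (fourier_coeff (act (inv g) \<eta>) F)"
proof -
  have "(\<Sum>\<tau>\<in>UNIV. config_char \<eta> $ \<tau> * wreath_rep (\<omega>, g) F $ (\<tau>, x))
      = config_char \<eta> $ \<omega> *
        (\<Sum>\<tau>\<in>UNIV. config_char (act (inv g) \<eta>) $ \<tau> * F $ (\<tau>, \<psi> (inv g) x))" for x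
  proof -
    have "bij (\<lambda>\<tau> z. \<omega> z + act g \<tau> z)"
      using bij_comp[OF bij_act[OF g] bij_config_translate[of \<omega>]] by (simp add: comp_def)
    then have "(\<Sum>\<tau>\<in>UNIV. config_char \<eta> $ \<tau> * wreath_rep (\<omega>, g) F $ (\<tau>, x))
        = (\<Sum>\<tau>\<in>UNIV. config_char \<eta> $ (\<lambda>z. \<omega> z + act g \<tau> z)
            * wreath_rep (\<omega>, g) F $ ((\<lambda>z. \<omega> z + act g \<tau> z), x))"
      by (rule sum.reindex_bij_betw[symmetric])
    also have "\<dots> = (\<Sum>\<tau>\<in>UNIV. config_char \<eta> $ \<omega> *
        (config_char (act (inv g) \<eta>) $ \<tau> * F $ (\<tau>, \<psi> (inv g) x)))"
    proof (intro sum.cong refl)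
      fix \<tau>
      have "a + (a + b) = b" for a b :: bit by (cases a; cases b) simp_all
      then have "wreath_rep (\<omega>, g) F $ ((\<lambda>z. \<omega> z + act g \<tau> z), x) = F $ (\<tau>, \<psi> (inv g) x)"
        using g by (simp only: wreath_rep_nth act_inv_act)
      then show "config_char \<eta> $ (\<lambda>z. \<omega> z + act g \<tau> z)
            * wreath_rep (\<omega>, g) F $ ((\<lambda>z. \<omega> z + act g \<tau> z), x)
          = config_char \<eta> $ \<omega> * (config_char (act (inv g) \<eta>) $ \<tau> * F $ (\<tau>, \<psi> (inv g) x))"
        using g by (simp only: config_char_add config_char_act inv_closed inv_inv mult.assoc)
    qed
    finally show ?thesis
      by (simp only: sum_distrib_left)
  qed
  then show ?thesis
    unfolding vec_eq_iff fourier_coeff_def vec_lambda_beta perm_rep_def[of G] vector_smult_component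
    by simp
qed

text \<open>Either side has at most one nonzero Fourier coefficient, at \<open>act g \<eta>\<close>,
  where the two agree.\<close>

lemma wreath_rep_tensor:
  assumes g: "g \<in> carrier G"
  shows "wreath_rep (\<omega>, g) (L_tensor (config_char \<eta>) f)
    = config_char (act g \<eta>) $ \<omega> *s L_tensor (config_char (act g \<eta>)) (base_rep g f)"
  by (rule fourier_eqI)
    (auto simp: fourier_coeff_wreath_rep[OF g] fourier_coeff_scale fourier_coeff_tensor
      act_inv_eq_iff[OF g])

subsection \<open>Fibers of subrepresentations\<close>

text \<open>Encoded by membership of pure tensors rather than as the image of \<open>U\<close> under
  \<open>fourier_coeff \<eta>\<close>. For a subrepresentation the two sets agree, by
  \<open>fourier_coeff_in_fiber\<close> and \<open>fourier_coeff_tensor\<close>.\<close>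

definition fiber ::
    "('z \<Rightarrow> bit) \<Rightarrow> (complex ^ (('z \<Rightarrow> bit) \<times> 'x)) set \<Rightarrow> (complex ^ 'x) set" where
  "fiber \<eta> U = {f. L_tensor (config_char \<eta>) f \<in> U}"

text \<open>An element \<open>(\<omega>, \<one>)\<close> multiplies the coefficient at
  \<open>\<zeta>\<close> by \<open>config_char \<zeta> $ \<omega>\<close>, so averaging against
  \<open>config_char \<eta>\<close> kills every coefficient except the one at \<open>\<eta>\<close>.
  Written through group elements, the projection visibly preserves subrepresentations and commutes
  with intertwiners.\<close>

lemma tensor_fourier_coeff:
  "L_tensor (config_char \<eta>) (fourier_coeff \<eta> F)
    = (1 / of_nat CARD('z \<Rightarrow> bit)) *s (\<Sum>\<omega>\<in>UNIV. config_char \<eta> $ \<omega> *s wreath_rep (\<omega>, \<one>) F)"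
proof (rule fourier_eqI)
  fix \<zeta>
  have "(\<Sum>\<omega>\<in>UNIV. config_char \<eta> $ \<omega> *s (config_char \<zeta> $ \<omega> *s fourier_coeff \<zeta> F))
      = (\<Sum>\<omega>\<in>UNIV. config_char \<eta> $ \<omega> * config_char \<zeta> $ \<omega>) *s fourier_coeff \<zeta> F"
    by (simp only: vec.scale_sum_left vec.scale_scale)
  also have "\<dots> = (if \<eta> = \<zeta> then of_nat CARD('z \<Rightarrow> bit) else 0) *s fourier_coeff \<zeta> F"
    by (simp only: config_char_orthogonal)
  finally show "fourier_coeff \<zeta> (L_tensor (config_char \<eta>) (fourier_coeff \<eta> F))
      = fourier_coeff \<zeta> ((1 / of_nat CARD('z \<Rightarrow> bit)) *s
          (\<Sum>\<omega>\<in>UNIV. config_char \<eta> $ \<omega> *s wreath_rep (\<omega>, \<one>) F))"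
    unfolding fourier_coeff_scale fourier_coeff_sum fourier_coeff_wreath_rep[OF one_closed]
      fourier_coeff_tensor inv_one act_one base_rep_one
    by auto
qed

lemma fourier_coeff_in_fiber:
  assumes U: "subrep wreath_group wreath_rep U" and F: "F \<in> U"
  shows "fourier_coeff \<eta> F \<in> fiber \<eta> U"
  unfolding fiber_def mem_Collect_eq tensor_fourier_coeff
  by (intro vec.subspace_scale vec.subspace_sum subrep_subspace[OF U] subrep_closed[OF U] F) simp

text \<open>The projections of a member stay in \<open>U\<close>, and inversion adds them up again;
  a subrepresentation is therefore determined by its fibers.\<close>

lemma subrep_mem_iff:
  assumes U: "subrep wreath_group wreath_rep U"
  shows "F \<in> U \<longleftrightarrow> (\<forall>\<eta>. fourier_coeff \<eta> F \<in> fiber \<eta> U)"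
proof
  assume "\<forall>\<eta>. fourier_coeff \<eta> F \<in> fiber \<eta> U"
  then have "(\<Sum>\<eta>\<in>UNIV. L_tensor (config_char \<eta>) (fourier_coeff \<eta> F)) \<in> U"
    by (intro vec.subspace_sum subrep_subspace[OF U]) (simp add: fiber_def)
  then show "F \<in> U" by (simp add: fourier_inversion)
qed (simp add: fourier_coeff_in_fiber[OF U])

lemma subspace_fiber:
  assumes "vec.subspace U"
  shows "vec.subspace (fiber \<eta> U)"
  using assms unfolding fiber_def
  by (intro vec.subspaceI)
    (simp_all add: L_tensor_add L_tensor_scale vec.subspace_0 vec.subspace_add vec.subspace_scale)

text \<open>The element with zero configuration and group part \<open>g\<close> moves a pure tensor
  at \<open>\<eta>\<close> to one at \<open>act g \<eta>\<close>, with scalar 1.\<close>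

lemma base_rep_in_fiber:
  assumes U: "subrep wreath_group wreath_rep U" and g: "g \<in> carrier G" and f: "f \<in> fiber \<eta> U"
  shows "base_rep g f \<in> fiber (act g \<eta>) U"
proof -
  have "wreath_rep ((\<lambda>z. 0), g) (L_tensor (config_char \<eta>) f) \<in> U"
    using f g by (intro subrep_closed[OF U]) (simp_all add: fiber_def)
  moreover have "config_char (act g \<eta>) $ (\<lambda>z. 0) = 1"
    by (simp add: config_char_def)
  ultimately show ?thesis
    by (simp add: wreath_rep_tensor[OF g] fiber_def)
qed

lemma carrier_stab [simp]: "g \<in> carrier (stab_group G \<phi> \<theta>) \<longleftrightarrow> g \<in> carrier G \<and> act g \<theta> = \<theta>"
  by (simp add: stab_group_def stabilizer_def)

lemma subrep_fiber:
  assumes U: "subrep wreath_group wreath_rep U"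
  shows "subrep (stab_group G \<phi> \<theta>) base_rep (fiber \<theta> U)"
  unfolding subrep_def
  using subspace_fiber[OF subrep_subspace[OF U]] base_rep_in_fiber[OF U] by fastforce

subsection \<open>Induced subrepresentations\<close>

text \<open>A concrete model of induction from the stabilizer: the coefficient at
  \<open>act g \<theta>\<close> lies in the translate of \<open>A\<close> by \<open>g\<close>.
  Quantifying over all \<open>g\<close> instead of coset representatives keeps choices out; for
  invariant \<open>A\<close> the conditions coming from one coset agree.\<close>

definition induced ::
    "('z \<Rightarrow> bit) \<Rightarrow> (complex ^ 'x) set \<Rightarrow> (complex ^ (('z \<Rightarrow> bit) \<times> 'x)) set" where
  "induced \<theta> A = {F. (\<forall>\<eta>. \<eta> \<notin> orbit G act \<theta> \<longrightarrow> fourier_coeff \<eta> F = 0) \<and>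
                      (\<forall>g\<in>carrier G. base_rep (inv g) (fourier_coeff (act g \<theta>) F) \<in> A)}"

lemma in_orbit_iff: "\<eta> \<in> orbit G act \<theta> \<longleftrightarrow> (\<exists>g\<in>carrier G. \<eta> = act g \<theta>)"
  by (auto simp: orbit_def)

lemma act_in_orbit [simp]: "g \<in> carrier G \<Longrightarrow> act g \<theta> \<in> orbit G act \<theta>"
  by (auto simp: in_orbit_iff)

lemma orbit_self [simp]: "\<theta> \<in> orbit G act \<theta>"
  using act_in_orbit[OF one_closed, of \<theta>] by simp

lemma act_in_orbit_iff:
  assumes "g \<in> carrier G"
  shows "act g \<eta> \<in> orbit G act \<theta> \<longleftrightarrow> \<eta> \<in> orbit G act \<theta>"
proof
  assume "act g \<eta> \<in> orbit G act \<theta>"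
  then obtain h where h: "h \<in> carrier G" "act g \<eta> = act h \<theta>"
    by (auto simp: in_orbit_iff)
  then have "\<eta> = act (inv g \<otimes> h) \<theta>"
    using assms by (metis act_inv_act act_mult inv_closed)
  then show "\<eta> \<in> orbit G act \<theta>"
    using assms h by simp
next
  assume "\<eta> \<in> orbit G act \<theta>"
  then obtain h where "h \<in> carrier G" "\<eta> = act h \<theta>"
    by (auto simp: in_orbit_iff)
  then show "act g \<eta> \<in> orbit G act \<theta>"
    using assms by (auto simp flip: act_mult)
qed

lemma inducedD:
  assumes "F \<in> induced \<theta> A"
  shows "\<eta> \<notin> orbit G act \<theta> \<Longrightarrow> fourier_coeff \<eta> F = 0"
    and "g \<in> carrier G \<Longrightarrow> base_rep (inv g) (fourier_coeff (act g \<theta>) F) \<in> A"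
  using assms by (auto simp: induced_def)

lemma induced_mono: "A \<subseteq> B \<Longrightarrow> induced \<theta> A \<subseteq> induced \<theta> B"
  by (auto simp: induced_def)

text \<open>Coefficients off the orbit vanish on both sides. Allowing two different spaces permits
  comparison with \<open>0\<close> as a member of \<open>induced \<theta> {0}\<close>, or with an
  image known only to lie in \<open>induced \<theta> UNIV\<close>.\<close>

lemma induced_eqI:
  assumes "F \<in> induced \<theta> A" "F' \<in> induced \<theta> A'"
    and "\<And>g. g \<in> carrier G \<Longrightarrow> fourier_coeff (act g \<theta>) F = fourier_coeff (act g \<theta>) F'"
  shows "F = F'"
proof (rule fourier_eqI)
  fix \<eta>
  show "fourier_coeff \<eta> F = fourier_coeff \<eta> F'"
    using assms(3) inducedD(1)[OF assms(1), of \<eta>] inducedD(1)[OF assms(2), of \<eta>]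
    by (cases "\<eta> \<in> orbit G act \<theta>") (auto simp: in_orbit_iff)
qed

lemma base_rep_eq_0_iff [simp]: "g \<in> carrier G \<Longrightarrow> base_rep g f = 0 \<longleftrightarrow> f = 0"
  by (metis base_rep_inv_rep perm_rep_zero)

lemma induced_zero: "induced \<theta> {0} = {0}"
proof -
  have zero: "0 \<in> induced \<theta> {0}" by (simp add: induced_def)
  have "F = 0" if F: "F \<in> induced \<theta> {0}" for F
    using inducedD(2)[OF F] by (intro induced_eqI[OF F zero]) simp
  then show ?thesis using zero by blast
qed

text \<open>The coefficient at \<open>act g \<theta>\<close> of the moved function is, up to a
  scalar, \<open>h\<close> applied to the old coefficient at
  \<open>act (inv h \<otimes> g) \<theta>\<close>. Translating it back by \<open>g\<close> is
  therefore translating the old one back by \<open>inv h \<otimes> g\<close>.\<close>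

lemma subrep_induced:
  assumes A: "vec.subspace A"
  shows "subrep wreath_group wreath_rep (induced \<theta> A)"
  unfolding subrep_def
proof (intro conjI ballI)
  show "vec.subspace (induced \<theta> A)"
    using A unfolding induced_def
    by (intro vec.subspaceI)
      (simp_all add: fourier_coeff_add fourier_coeff_scale perm_rep_add perm_rep_scale
        vec.subspace_0 vec.subspace_add vec.subspace_scale)
next
  fix p F assume "p \<in> carrier wreath_group" and F: "F \<in> induced \<theta> A"
  then obtain \<omega> h where p: "p = (\<omega>, h)" and h: "h \<in> carrier G"
    by (metis carrier_wreath surj_pair)
  show "wreath_rep p F \<in> induced \<theta> A"
    unfolding induced_def p
  proof (intro CollectI conjI allI impI ballI)
    fix \<eta> assume "\<eta> \<notin> orbit G act \<theta>"
    then have "act (inv h) \<eta> \<notin> orbit G act \<theta>"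
      using h by (simp add: act_in_orbit_iff)
    then show "fourier_coeff \<eta> (wreath_rep (\<omega>, h) F) = 0"
      by (simp add: fourier_coeff_wreath_rep h inducedD[OF F])
  next
    fix g assume g: "g \<in> carrier G"
    have "base_rep (inv (inv h \<otimes> g)) (fourier_coeff (act (inv h \<otimes> g) \<theta>) F) \<in> A"
      using g h by (intro inducedD(2)[OF F]) simp
    then have "base_rep (inv g) (base_rep h (fourier_coeff (act (inv h) (act g \<theta>)) F)) \<in> A"
      using g h by (simp add: inv_mult_group base_rep_mult act_mult)
    then show "base_rep (inv g) (fourier_coeff (act g \<theta>) (wreath_rep (\<omega>, h) F)) \<in> A"
      by (simp add: fourier_coeff_wreath_rep h perm_rep_scale vec.subspace_scale[OF A])
  qed
qed

text \<open>A pure tensor at \<open>\<theta>\<close> is constrained only by the elements fixing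
  \<open>\<theta>\<close>. Invariance of \<open>A\<close> makes these constraints follow from
  \<open>f \<in> A\<close>, and the identity element gives the converse.\<close>

lemma fiber_induced:
  assumes A: "subrep (stab_group G \<phi> \<theta>) base_rep A"
  shows "fiber \<theta> (induced \<theta> A) = A"
proof (rule Set.set_eqI)
  fix f
  have "base_rep (inv g) f \<in> A" if "f \<in> A" "g \<in> carrier G" "act g \<theta> = \<theta>" for g
    using that by (intro subrep_closed[OF A]) (auto simp: act_inv_eq_iff)
  moreover have "f \<in> A" if "\<forall>g\<in>carrier G. act g \<theta> = \<theta> \<longrightarrow> base_rep (inv g) f \<in> A"
    using that[rule_format, OF one_closed] by simp
  ultimately show "f \<in> fiber \<theta> (induced \<theta> A) \<longleftrightarrow> f \<in> A"
    using vec.subspace_0[OF subrep_subspace[OF A]]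
    by (auto simp: fiber_def induced_def fourier_coeff_tensor)
qed

lemma fiber_induced_off_orbit:
  assumes "\<eta> \<notin> orbit G act \<theta>" "vec.subspace A"
  shows "fiber \<eta> (induced \<theta> A) = {0}"
proof -
  have "f = 0" if "f \<in> fiber \<eta> (induced \<theta> A)" for f
    using that assms(1) inducedD(1)[of "L_tensor (config_char \<eta>) f" \<theta> A \<eta>]
    by (simp add: fiber_def fourier_coeff_tensor)
  moreover have "0 \<in> fiber \<eta> (induced \<theta> A)"
    by (intro vec.subspace_0 subspace_fiber subrep_subspace[OF subrep_induced] assms)
  ultimately show ?thesis by blast
qed

text \<open>Membership in \<open>U\<close> is tested on fibers. Translation by \<open>g\<close>
  identifies the fiber over \<open>\<theta>\<close> with the one over \<open>act g \<theta>\<close>,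
  and off the orbit only zero coefficients are allowed on either side. Together with
  \<open>fiber_induced\<close>, this makes taking fibers and inducing mutually inverse.\<close>

lemma induced_fiber:
  assumes U: "subrep wreath_group wreath_rep U"
    and off: "\<And>\<eta>. \<eta> \<notin> orbit G act \<theta> \<Longrightarrow> fiber \<eta> U = {0}"
  shows "induced \<theta> (fiber \<theta> U) = U"
proof (rule Set.set_eqI)
  fix F
  have on: "base_rep (inv g) (fourier_coeff (act g \<theta>) F) \<in> fiber \<theta> U
      \<longleftrightarrow> fourier_coeff (act g \<theta>) F \<in> fiber (act g \<theta>) U" if g: "g \<in> carrier G" for g
    using base_rep_in_fiber[OF U g, of "base_rep (inv g) (fourier_coeff (act g \<theta>) F)" \<theta>]
      base_rep_in_fiber[OF U inv_closed[OF g], of "fourier_coeff (act g \<theta>) F" "act g \<theta>"] g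
    by auto
  show "F \<in> induced \<theta> (fiber \<theta> U) \<longleftrightarrow> F \<in> U"
  proof
    assume F: "F \<in> induced \<theta> (fiber \<theta> U)"
    show "F \<in> U"
      unfolding subrep_mem_iff[OF U]
    proof
      fix \<eta>
      show "fourier_coeff \<eta> F \<in> fiber \<eta> U"
        using inducedD[OF F] on off by (cases "\<eta> \<in> orbit G act \<theta>") (auto simp: in_orbit_iff)
    qed
  next
    assume F: "F \<in> U"
    show "F \<in> induced \<theta> (fiber \<theta> U)"
      unfolding induced_def
      using fourier_coeff_in_fiber[OF U F] on off by blast
  qed
qed

text \<open>Lying inside an induced space forces the fibers off the orbit to vanish, which is the
  support condition of \<open>induced_fiber\<close>.\<close>

lemma induced_fiber_of_subset:
  assumes U: "subrep wreath_group wreath_rep U" and "U \<subseteq> induced \<theta> A" and A: "vec.subspace A"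
  shows "induced \<theta> (fiber \<theta> U) = U"
proof (rule induced_fiber[OF U])
  fix \<eta> assume "\<eta> \<notin> orbit G act \<theta>"
  then have "fiber \<eta> U \<subseteq> {0}"
    using fiber_induced_off_orbit[OF _ A] assms(2) by (auto simp: fiber_def)
  then show "fiber \<eta> U = {0}"
    using vec.subspace_0[OF subspace_fiber[OF subrep_subspace[OF U]]] by blast
qed

text \<open>A subrepresentation of the induced space is induced from its fiber, which is a
  subrepresentation of \<open>A\<close>. Irreducibility of \<open>A\<close> leaves two possible
  fibers, hence two subrepresentations.\<close>

lemma irreducible_induced:
  assumes "irreducible_subrep (stab_group G \<phi> \<theta>) base_rep A"
  shows "irreducible_subrep wreath_group wreath_rep (induced \<theta> A)"
proof -
  have A: "subrep (stab_group G \<phi> \<theta>) base_rep A" and "A \<noteq> {0}"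
    and irr: "\<And>B. subrep (stab_group G \<phi> \<theta>) base_rep B \<Longrightarrow> B \<subseteq> A \<Longrightarrow> B = {0} \<or> B = A"
    using assms by (auto simp: irreducible_subrep_def)
  show ?thesis
    unfolding irreducible_subrep_def
  proof (intro conjI allI impI)
    show "subrep wreath_group wreath_rep (induced \<theta> A)"
      by (rule subrep_induced[OF subrep_subspace[OF A]])
    have "fiber \<theta> (induced \<theta> {0}) = {0}"
      by (rule fiber_induced) (simp add: subrep_def)
    then show "induced \<theta> A \<noteq> {0}"
      using fiber_induced[OF A] \<open>A \<noteq> {0}\<close> by (auto simp: induced_zero)
    fix U assume "subrep wreath_group wreath_rep U \<and> U \<subseteq> induced \<theta> A"
    then have U: "subrep wreath_group wreath_rep U" and "U \<subseteq> induced \<theta> A" by auto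
    then have "induced \<theta> (fiber \<theta> U) = U"
      using induced_fiber_of_subset subrep_subspace[OF A] by blast
    moreover have "fiber \<theta> U \<subseteq> A"
      using \<open>U \<subseteq> induced \<theta> A\<close> fiber_induced[OF A] by (auto simp: fiber_def)
    then have "fiber \<theta> U = {0} \<or> fiber \<theta> U = A"
      by (intro irr subrep_fiber U)
    ultimately show "U = {0} \<or> U = induced \<theta> A"
      using induced_zero by metis
  qed
qed

subsection \<open>Equivalence\<close>

text \<open>An intertwiner commutes with the projections onto the Fourier components, hence
  restricts to each fiber.\<close>

lemma equivalent_fiber:
  assumes eq: "equivalent_subreps wreath_group wreath_rep U U'"
    and U: "subrep wreath_group wreath_rep U" and U': "subrep wreath_group wreath_rep U'"
  shows "equivalent_subreps (stab_group G \<phi> \<theta>) base_rep (fiber \<theta> U) (fiber \<theta> U')"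
proof -
  obtain T where T: "bij_betw T U U'"
    and T_add: "\<And>F F'. F \<in> U \<Longrightarrow> F' \<in> U \<Longrightarrow> T (F + F') = T F + T F'"
    and T_scale: "\<And>c F. F \<in> U \<Longrightarrow> T (c *s F) = c *s T F"
    and T_rep: "\<And>h F. h \<in> carrier wreath_group \<Longrightarrow> F \<in> U \<Longrightarrow> T (wreath_rep h F) = wreath_rep h (T F)"
    using eq unfolding equivalent_subreps_def by blast
  note sub = subrep_subspace[OF U]
  \<comment> \<open>\<open>T\<close> is linear on \<open>U\<close> only, so each partial sum has to
    stay inside \<open>U\<close>.\<close>
  have T_sum: "T (\<Sum>i\<in>I. v i) = (\<Sum>i\<in>I. T (v i))" if "finite I" "\<And>i. i \<in> I \<Longrightarrow> v i \<in> U" for I and v :: "_ \<Rightarrow> _"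
    using that
  proof (induction I rule: finite_induct)
    case empty
    show ?case using T_scale[of 0 0] vec.subspace_0[OF sub] by simp
  next
    case (insert i I)
    then show ?case by (simp add: T_add vec.subspace_sum[OF sub])
  qed
  have T_proj: "T (L_tensor (config_char \<theta>) (fourier_coeff \<theta> F))
      = L_tensor (config_char \<theta>) (fourier_coeff \<theta> (T F))" if F: "F \<in> U" for F
  proof -
    have R: "wreath_rep (\<omega>, \<one>) F \<in> U" for \<omega>
      by (rule subrep_closed[OF U _ F]) simp
    then show ?thesis
      unfolding tensor_fourier_coeff
      by (simp add: T_scale T_sum T_rep F vec.subspace_sum[OF sub] vec.subspace_scale[OF sub])
  qed
  \<comment> \<open>\<open>t\<close> is \<open>T\<close> seen through the identification of a fiber
    with the pure tensors at \<open>\<theta>\<close>.\<close>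
  define t where "t f = fourier_coeff \<theta> (T (L_tensor (config_char \<theta>) f))" for f
  have t: "T (L_tensor (config_char \<theta>) f) = L_tensor (config_char \<theta>) (t f)" if "f \<in> fiber \<theta> U" for f
    using T_proj[of "L_tensor (config_char \<theta>) f"] that
    by (simp add: fiber_def t_def fourier_coeff_tensor)
  have "bij_betw t (fiber \<theta> U) (fiber \<theta> U')"
    unfolding bij_betw_def
  proof
    show "inj_on t (fiber \<theta> U)"
    proof (rule inj_onI)
      fix f f' assume f: "f \<in> fiber \<theta> U" "f' \<in> fiber \<theta> U" "t f = t f'"
      then have "T (L_tensor (config_char \<theta>) f) = T (L_tensor (config_char \<theta>) f')"
        by (simp add: t)
      then have "L_tensor (config_char \<theta>) f = L_tensor (config_char \<theta>) f'"
        using f T unfolding bij_betw_def fiber_def by (auto dest: inj_onD)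
      then have "fourier_coeff \<theta> (L_tensor (config_char \<theta>) f)
          = fourier_coeff \<theta> (L_tensor (config_char \<theta>) f')" by simp
      then show "f = f'" by (simp add: fourier_coeff_tensor)
    qed
    show "t ` fiber \<theta> U = fiber \<theta> U'"
    proof
      show "t ` fiber \<theta> U \<subseteq> fiber \<theta> U'"
      proof
        fix f' assume "f' \<in> t ` fiber \<theta> U"
        then obtain f where f: "f \<in> fiber \<theta> U" "f' = t f" by blast
        then have "T (L_tensor (config_char \<theta>) f) \<in> U'"
          using T by (auto simp: bij_betw_def fiber_def)
        then show "f' \<in> fiber \<theta> U'" using t f by (simp add: fiber_def)
      qed
      show "fiber \<theta> U' \<subseteq> t ` fiber \<theta> U"
      proof
        fix f assume "f \<in> fiber \<theta> U'"
        then obtain F where F: "F \<in> U" "L_tensor (config_char \<theta>) f = T F"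
          using T by (auto simp: bij_betw_def fiber_def)
        \<comment> \<open>The preimage \<open>F\<close> need not be known to be a pure tensor: its
          coefficient at \<open>\<theta>\<close> maps to \<open>f\<close>, because \<open>T\<close>
          commutes with the projection.\<close>
        have "t (fourier_coeff \<theta> F) = fourier_coeff \<theta> (L_tensor (config_char \<theta>) (fourier_coeff \<theta> (T F)))"
          by (simp add: t_def T_proj F)
        also have "\<dots> = f"
          by (simp add: fourier_coeff_tensor flip: F(2))
        finally show "f \<in> t ` fiber \<theta> U"
          using fourier_coeff_in_fiber[OF U F(1)] by blast
      qed
    qed
  qed
  moreover have "t (base_rep h f) = base_rep h (t f)"
    if h: "h \<in> carrier (stab_group G \<phi> \<theta>)" and f: "f \<in> fiber \<theta> U" for h f
  proof -
    have h': "h \<in> carrier G" "act h \<theta> = \<theta>" "act (inv h) \<theta> = \<theta>"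
      using h by (auto simp: act_inv_eq_iff)
    have one: "config_char \<theta> $ (\<lambda>z. 0) = 1"
      by (simp add: config_char_def)
    have "L_tensor (config_char \<theta>) (base_rep h f) = wreath_rep ((\<lambda>z. 0), h) (L_tensor (config_char \<theta>) f)"
      by (simp add: wreath_rep_tensor h' one)
    then show ?thesis
      using f by (simp add: t_def T_rep fiber_def h' fourier_coeff_wreath_rep one)
  qed
  ultimately show ?thesis
    unfolding equivalent_subreps_def
    by (intro exI[of _ t])
      (simp add: t_def L_tensor_add L_tensor_scale T_add T_scale fiber_def fourier_coeff_add
        fourier_coeff_scale)
qed

text \<open>The value does not depend on the choice of \<open>g\<close> when \<open>t\<close> commutes with the stabilizer.\<close>

definition induced_map ::
    "('z \<Rightarrow> bit) \<Rightarrow> (complex ^ 'x \<Rightarrow> complex ^ 'x) \<Rightarrow>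
     complex ^ (('z \<Rightarrow> bit) \<times> 'x) \<Rightarrow> complex ^ (('z \<Rightarrow> bit) \<times> 'x)" where
  "induced_map \<theta> t F = (\<Sum>\<eta>\<in>UNIV. L_tensor (config_char \<eta>)
     (if \<eta> \<in> orbit G act \<theta> then
        let g = (SOME g. g \<in> carrier G \<and> act g \<theta> = \<eta>)
        in base_rep g (t (base_rep (inv g) (fourier_coeff \<eta> F)))
      else 0))"

text \<open>The chosen \<open>h\<close> and the given \<open>g\<close> send \<open>\<theta>\<close>
  to the same point, so they differ by the stabilizer element \<open>inv h \<otimes> g\<close>.
  Moving \<open>t\<close> past it replaces the choice by \<open>g\<close>.\<close>

lemma induced_map_coeff:
  assumes t: "\<And>h f. h \<in> carrier (stab_group G \<phi> \<theta>) \<Longrightarrow> f \<in> A \<Longrightarrow> t (base_rep h f) = base_rep h (t f)"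
    and F: "F \<in> induced \<theta> A" and g: "g \<in> carrier G"
  shows "fourier_coeff (act g \<theta>) (induced_map \<theta> t F)
    = base_rep g (t (base_rep (inv g) (fourier_coeff (act g \<theta>) F)))"
proof -
  let ?x = "fourier_coeff (act g \<theta>) F"
  define h where "h = (SOME h. h \<in> carrier G \<and> act h \<theta> = act g \<theta>)"
  have h: "h \<in> carrier G" "act h \<theta> = act g \<theta>"
    using someI[of "\<lambda>h. h \<in> carrier G \<and> act h \<theta> = act g \<theta>" g] g by (auto simp: h_def)
  let ?k = "inv h \<otimes> g"
  have "act ?k \<theta> = \<theta>"
    using g h by (metis act_inv_act act_mult inv_closed)
  then have k: "?k \<in> carrier (stab_group G \<phi> \<theta>)"
    using g h by simp
  have "base_rep ?k (base_rep (inv g) ?x) = base_rep (inv h) ?x"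
    using g h by (simp add: base_rep_mult)
  then have "base_rep h (t (base_rep (inv h) ?x)) = base_rep h (t (base_rep ?k (base_rep (inv g) ?x)))"
    by simp
  also have "\<dots> = base_rep h (base_rep ?k (t (base_rep (inv g) ?x)))"
    by (simp only: t[OF k inducedD(2)[OF F g]])
  also have "\<dots> = base_rep g (t (base_rep (inv g) ?x))"
    using g h by (simp add: base_rep_mult)
  finally show ?thesis
    unfolding induced_map_def fourier_coeff_synthesis using g by (simp add: h_def)
qed

lemma induced_map_in:
  assumes "\<And>h f. h \<in> carrier (stab_group G \<phi> \<theta>) \<Longrightarrow> f \<in> A \<Longrightarrow> t (base_rep h f) = base_rep h (t f)"
    and "\<And>f. f \<in> A \<Longrightarrow> t f \<in> B" and F: "F \<in> induced \<theta> A"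
  shows "induced_map \<theta> t F \<in> induced \<theta> B"
  unfolding induced_def
proof (intro CollectI conjI allI impI ballI)
  fix \<eta> assume "\<eta> \<notin> orbit G act \<theta>"
  then show "fourier_coeff \<eta> (induced_map \<theta> t F) = 0"
    unfolding induced_map_def fourier_coeff_synthesis by simp
next
  fix g assume g: "g \<in> carrier G"
  have "fourier_coeff (act g \<theta>) (induced_map \<theta> t F)
      = base_rep g (t (base_rep (inv g) (fourier_coeff (act g \<theta>) F)))"
    using assms(1) F g by (rule induced_map_coeff)
  then show "base_rep (inv g) (fourier_coeff (act g \<theta>) (induced_map \<theta> t F)) \<in> B"
    using g inducedD(2)[OF F g] by (simp add: assms(2))
qed

text \<open>At each orbit point the inner translations by \<open>g\<close> and \<open>inv g\<close>
  cancel, leaving \<open>s\<close> after \<open>t\<close> on \<open>A\<close>. The lemma serves both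
  directions of a bijection, with the roles exchanged.\<close>

lemma induced_map_inverse:
  assumes t: "\<And>h f. h \<in> carrier (stab_group G \<phi> \<theta>) \<Longrightarrow> f \<in> A \<Longrightarrow> t (base_rep h f) = base_rep h (t f)"
    and s: "\<And>h f. h \<in> carrier (stab_group G \<phi> \<theta>) \<Longrightarrow> f \<in> B \<Longrightarrow> s (base_rep h f) = base_rep h (s f)"
    and tB: "\<And>f. f \<in> A \<Longrightarrow> t f \<in> B" and st: "\<And>f. f \<in> A \<Longrightarrow> s (t f) = f" and F: "F \<in> induced \<theta> A"
  shows "induced_map \<theta> s (induced_map \<theta> t F) = F"
proof -
  have tF: "induced_map \<theta> t F \<in> induced \<theta> B"
    using t tB F by (rule induced_map_in)
  \<comment> \<open>Membership with \<open>UNIV\<close> records just the support on the orbit, which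
    is all that the comparison of coefficients requires.\<close>
  have "induced_map \<theta> s (induced_map \<theta> t F) \<in> induced \<theta> UNIV"
    using s UNIV_I tF by (rule induced_map_in)
  then show ?thesis
  proof (rule induced_eqI[OF _ F])
    fix g assume g: "g \<in> carrier G"
    have "fourier_coeff (act g \<theta>) (induced_map \<theta> s (induced_map \<theta> t F))
        = base_rep g (s (base_rep (inv g) (fourier_coeff (act g \<theta>) (induced_map \<theta> t F))))"
      using s tF g by (rule induced_map_coeff)
    also have "fourier_coeff (act g \<theta>) (induced_map \<theta> t F)
        = base_rep g (t (base_rep (inv g) (fourier_coeff (act g \<theta>) F)))"
      using t F g by (rule induced_map_coeff)
    finally show "fourier_coeff (act g \<theta>) (induced_map \<theta> s (induced_map \<theta> t F)) = fourier_coeff (act g \<theta>) F"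
      using g inducedD(2)[OF F g] by (simp add: st)
  qed
qed

text \<open>The map induced by an intertwiner is inverted by the map induced from the inverse
  intertwiner. All identities are checked on coefficients over the orbit, where
  \<open>induced_map\<close> acts as \<open>t\<close> conjugated by a group element.\<close>

lemma equivalent_induced:
  assumes eq: "equivalent_subreps (stab_group G \<phi> \<theta>) base_rep A B"
    and A: "subrep (stab_group G \<phi> \<theta>) base_rep A" and B: "subrep (stab_group G \<phi> \<theta>) base_rep B"
  shows "equivalent_subreps wreath_group wreath_rep (induced \<theta> A) (induced \<theta> B)"
proof -
  let ?K = "carrier (stab_group G \<phi> \<theta>)"
  obtain t where t: "bij_betw t A B"
    and t_add: "\<And>f f'. f \<in> A \<Longrightarrow> f' \<in> A \<Longrightarrow> t (f + f') = t f + t f'"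
    and t_scale: "\<And>c f. f \<in> A \<Longrightarrow> t (c *s f) = c *s t f"
    and t_rep: "\<And>h f. h \<in> ?K \<Longrightarrow> f \<in> A \<Longrightarrow> t (base_rep h f) = base_rep h (t f)"
    using eq unfolding equivalent_subreps_def by blast
  define s where "s = inv_into A t"
  have tB: "t f \<in> B" and st: "s (t f) = f" if "f \<in> A" for f
    using t that by (auto simp: s_def bij_betw_def)
  have sA: "s f \<in> A" and ts: "t (s f) = f" if "f \<in> B" for f
    using t that by (auto simp: s_def bij_betw_def inv_into_into f_inv_into_f)
  have s_rep: "s (base_rep h f) = base_rep h (s f)" if "h \<in> ?K" "f \<in> B" for h f
    using st[OF subrep_closed[OF A that(1) sA[OF that(2)]]] that by (simp add: t_rep sA ts)
  let ?T = "induced_map \<theta> t"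
  have coeff: "fourier_coeff (act g \<theta>) (?T F) = base_rep g (t (base_rep (inv g) (fourier_coeff (act g \<theta>) F)))"
    if "F \<in> induced \<theta> A" "g \<in> carrier G" for F g
    using t_rep that by (rule induced_map_coeff)
  have T_in: "?T F \<in> induced \<theta> B" if "F \<in> induced \<theta> A" for F
    using t_rep tB that by (rule induced_map_in)
  note IA = subrep_induced[OF subrep_subspace[OF A], of \<theta>] and IB = subrep_induced[OF subrep_subspace[OF B], of \<theta>]
  note sA_ind = subrep_subspace[OF IA] and sB_ind = subrep_subspace[OF IB]
  show ?thesis
    unfolding equivalent_subreps_def
  proof (intro exI[of _ ?T] conjI ballI allI)
    show "bij_betw ?T (induced \<theta> A) (induced \<theta> B)"
    proof (rule bij_betw_byWitness[where f' = "induced_map \<theta> s"])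
      show "\<forall>F\<in>induced \<theta> A. induced_map \<theta> s (?T F) = F"
        using induced_map_inverse[of \<theta> A t B s, OF t_rep s_rep tB st] by blast
      show "\<forall>F\<in>induced \<theta> B. ?T (induced_map \<theta> s F) = F"
        using induced_map_inverse[of \<theta> B s A t, OF s_rep t_rep sA ts] by blast
      show "?T ` induced \<theta> A \<subseteq> induced \<theta> B"
        using T_in by blast
      show "induced_map \<theta> s ` induced \<theta> B \<subseteq> induced \<theta> A"
        using induced_map_in[of \<theta> B s A, OF s_rep sA] by blast
    qed
  next
    fix F F' assume F: "F \<in> induced \<theta> A" and F': "F' \<in> induced \<theta> A"
    have FF: "F + F' \<in> induced \<theta> A" by (rule vec.subspace_add[OF sA_ind F F'])
    show "?T (F + F') = ?T F + ?T F'"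
    proof (rule induced_eqI[OF T_in[OF FF] vec.subspace_add[OF sB_ind T_in[OF F] T_in[OF F']]])
      fix g assume g: "g \<in> carrier G"
      show "fourier_coeff (act g \<theta>) (?T (F + F')) = fourier_coeff (act g \<theta>) (?T F + ?T F')"
        using inducedD(2)[OF F g] inducedD(2)[OF F' g]
        by (simp add: coeff[OF FF g] coeff[OF F g] coeff[OF F' g] fourier_coeff_add perm_rep_add t_add)
    qed
  next
    fix c F assume F: "F \<in> induced \<theta> A"
    have cF: "c *s F \<in> induced \<theta> A" by (rule vec.subspace_scale[OF sA_ind F])
    show "?T (c *s F) = c *s ?T F"
    proof (rule induced_eqI[OF T_in[OF cF] vec.subspace_scale[OF sB_ind T_in[OF F]]])
      fix g assume g: "g \<in> carrier G"
      show "fourier_coeff (act g \<theta>) (?T (c *s F)) = fourier_coeff (act g \<theta>) (c *s ?T F)"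
        using inducedD(2)[OF F g]
        by (simp add: coeff[OF cF g] coeff[OF F g] fourier_coeff_scale perm_rep_scale t_scale)
    qed
  next
    fix p F assume p: "p \<in> carrier wreath_group" and F: "F \<in> induced \<theta> A"
    obtain \<omega> h where p_eq: "p = (\<omega>, h)" and h: "h \<in> carrier G"
      using p by (metis carrier_wreath surj_pair)
    have pF: "wreath_rep p F \<in> induced \<theta> A" by (rule subrep_closed[OF IA p F])
    show "?T (wreath_rep p F) = wreath_rep p (?T F)"
    proof (rule induced_eqI[OF T_in[OF pF] subrep_closed[OF IB p T_in[OF F]]])
      fix g assume g: "g \<in> carrier G"
      \<comment> \<open>Since \<open>p\<close> has group part \<open>h\<close>, the coefficient at
        \<open>act g \<theta>\<close> is fed by the one at \<open>act ?k \<theta>\<close>, and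
        \<open>g\<close> factors as \<open>h \<otimes> ?k\<close>.\<close>
      let ?k = "inv h \<otimes> g"
      let ?c = "config_char (act g \<theta>) $ \<omega>"
      have k: "?k \<in> carrier G" using g h by simp
      have act_k: "act (inv h) (act g \<theta>) = act ?k \<theta>" using g h by (simp add: act_mult)
      let ?y = "fourier_coeff (act ?k \<theta>) F"
      have y: "base_rep (inv g) (base_rep h ?y) = base_rep (inv ?k) ?y"
        using g h by (simp add: inv_mult_group base_rep_mult)
      have "fourier_coeff (act g \<theta>) (?T (wreath_rep p F))
          = base_rep g (t (base_rep (inv g) (?c *s base_rep h ?y)))"
        unfolding coeff[OF pF g] by (simp add: p_eq fourier_coeff_wreath_rep h act_k)
      also have "\<dots> = ?c *s base_rep g (t (base_rep (inv ?k) ?y))"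
        using inducedD(2)[OF F k] by (simp add: perm_rep_scale y t_scale)
      also have "base_rep g (t (base_rep (inv ?k) ?y)) = base_rep h (base_rep ?k (t (base_rep (inv ?k) ?y)))"
        using g h by (simp add: base_rep_mult)
      also have "\<dots> = base_rep h (fourier_coeff (act ?k \<theta>) (?T F))"
        by (simp only: coeff[OF F k])
      finally show "fourier_coeff (act g \<theta>) (?T (wreath_rep p F))
          = fourier_coeff (act g \<theta>) (wreath_rep p (?T F))"
        by (simp add: p_eq fourier_coeff_wreath_rep h act_k)
    qed
  qed
qed

section \<open>Isotypic components and inequivalence of induced representations\<close>

text \<open>An intertwiner restricts to every fiber, so the vanishing of the fibers of the induced
  space off the orbit passes to \<open>U\<close>.\<close>

lemma induced_fiber_of_equivalent:
  assumes U: "subrep wreath_group wreath_rep U" and A: "vec.subspace A"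
    and eq: "equivalent_subreps wreath_group wreath_rep U (induced \<theta> A)"
  shows "induced \<theta> (fiber \<theta> U) = U"
proof (rule induced_fiber[OF U])
  fix \<eta> assume "\<eta> \<notin> orbit G act \<theta>"
  then have "fiber \<eta> (induced \<theta> A) = {0}"
    using A by (rule fiber_induced_off_orbit)
  moreover note IA = subrep_induced[OF A, of \<theta>]
  have "fiber \<eta> U = {0} \<longleftrightarrow> fiber \<eta> (induced \<theta> A) = {0}"
    using equivalent_fiber[OF eq U IA] subspace_fiber[OF subrep_subspace[OF U]]
      subspace_fiber[OF subrep_subspace[OF IA]]
    by (rule equivalent_subreps_zero_iff)
  ultimately show "fiber \<eta> U = {0}" by blast
qed

text \<open>A copy of \<open>induced \<theta> A\<close> is induced from its fiber, which is a copy
  of \<open>A\<close>; conversely a copy of \<open>A\<close> induces a copy of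
  \<open>induced \<theta> A\<close>. The spans of these copies correspond accordingly.\<close>

lemma isotypic_component_induced:
  assumes A: "subrep (stab_group G \<phi> \<theta>) base_rep A"
  shows "isotypic_component wreath_group wreath_rep UNIV (induced \<theta> A)
    = induced \<theta> (isotypic_component (stab_group G \<phi> \<theta>) base_rep UNIV A)"
    (is "?L = induced \<theta> ?C")
proof
  have C: "subrep (stab_group G \<phi> \<theta>) base_rep ?C"
    by (rule subrep_isotypic_component)
  have L: "subrep wreath_group wreath_rep ?L"
    by (rule subrep_isotypic_component)
  show sub: "?L \<subseteq> induced \<theta> ?C"
    unfolding isotypic_component_def[of wreath_group]
  proof (rule vec.span_minimal[OF _ subrep_subspace[OF subrep_induced[OF subrep_subspace[OF C]]]], safe)
    fix U F assume U: "subrep wreath_group wreath_rep U"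
      and eq: "equivalent_subreps wreath_group wreath_rep U (induced \<theta> A)" and F: "F \<in> U"
    have "equivalent_subreps (stab_group G \<phi> \<theta>) base_rep (fiber \<theta> U) A"
      using equivalent_fiber[OF eq U subrep_induced[OF subrep_subspace[OF A]], of \<theta>]
      by (simp add: fiber_induced[OF A])
    then have "fiber \<theta> U \<subseteq> ?C"
      by (intro isotypic_component_upper subrep_fiber[OF U]) simp_all
    then have "induced \<theta> (fiber \<theta> U) \<subseteq> induced \<theta> ?C"
      by (rule induced_mono)
    then show "F \<in> induced \<theta> ?C"
      using F induced_fiber_of_equivalent[OF U subrep_subspace[OF A] eq] by auto
  qed
  \<comment> \<open>It is enough to compare fibers over \<open>\<theta>\<close>: \<open>?L\<close>
    lies in an induced space and is therefore induced from its own fiber.\<close>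
  have "?C \<subseteq> fiber \<theta> ?L"
    unfolding isotypic_component_def[of "stab_group G \<phi> \<theta>"]
  proof (rule vec.span_minimal[OF _ subspace_fiber[OF subrep_subspace[OF L]]], safe)
    fix B f assume B: "subrep (stab_group G \<phi> \<theta>) base_rep B"
      and eq: "equivalent_subreps (stab_group G \<phi> \<theta>) base_rep B A" and f: "f \<in> B"
    have "induced \<theta> B \<subseteq> ?L"
      by (intro isotypic_component_upper equivalent_induced[OF eq B A]
          subrep_induced[OF subrep_subspace[OF B]]) simp
    moreover have "f \<in> fiber \<theta> (induced \<theta> B)"
      using f by (simp add: fiber_induced[OF B])
    ultimately show "f \<in> fiber \<theta> ?L"
      by (auto simp: fiber_def)
  qed
  then have "induced \<theta> ?C \<subseteq> induced \<theta> (fiber \<theta> ?L)"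
    by (rule induced_mono)
  then show "induced \<theta> ?C \<subseteq> ?L"
    using induced_fiber_of_subset[OF L sub subrep_subspace[OF C]] by simp
qed

text \<open>Inducing carries an equivalence up to the wreath product, and taking fibers over
  \<open>\<theta>\<close> carries one back down.\<close>

lemma equivalent_induced_iff:
  assumes A: "subrep (stab_group G \<phi> \<theta>) base_rep A" and B: "subrep (stab_group G \<phi> \<theta>) base_rep B"
  shows "equivalent_subreps wreath_group wreath_rep (induced \<theta> A) (induced \<theta> B)
    \<longleftrightarrow> equivalent_subreps (stab_group G \<phi> \<theta>) base_rep A B"
  using equivalent_induced[OF _ A B]
    equivalent_fiber[OF _ subrep_induced[OF subrep_subspace[OF A]] subrep_induced[OF subrep_subspace[OF B]],
      of \<theta> \<theta> \<theta>]
  by (auto simp: fiber_induced[OF A] fiber_induced[OF B])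

text \<open>The fiber over \<open>\<theta>\<close> separates the two spaces: it is \<open>A\<close>
  for the first and zero for the second.\<close>

lemma not_equivalent_induced:
  assumes A: "subrep (stab_group G \<phi> \<theta>) base_rep A" "A \<noteq> {0}" and B: "vec.subspace B"
    and off: "\<theta> \<notin> orbit G act \<theta>'"
  shows "\<not> equivalent_subreps wreath_group wreath_rep (induced \<theta> A) (induced \<theta>' B)"
proof
  assume eq: "equivalent_subreps wreath_group wreath_rep (induced \<theta> A) (induced \<theta>' B)"
  note IA = subrep_induced[OF subrep_subspace[OF A(1)], of \<theta>] and IB = subrep_induced[OF B, of \<theta>']
  have "fiber \<theta> (induced \<theta> A) = {0} \<longleftrightarrow> fiber \<theta> (induced \<theta>' B) = {0}"
    using equivalent_fiber[OF eq IA IB] subspace_fiber[OF subrep_subspace[OF IA]]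
      subspace_fiber[OF subrep_subspace[OF IB]]
    by (rule equivalent_subreps_zero_iff)
  then show False
    using A fiber_induced[OF A(1)] fiber_induced_off_orbit[OF off B] by simp
qed

subsection \<open>Direct sums of induced subrepresentations\<close>

text \<open>By Parseval the scalar product is a sum over orbit points, and at each point unitarity
  of \<open>inv g\<close> moves both coefficients back into \<open>A\<close> and
  \<open>B\<close>.\<close>

lemma L_orthogonal_induced:
  assumes "L_orthogonal A B"
  shows "L_orthogonal (induced \<theta> A) (induced \<theta> B)"
  unfolding L_orthogonal_def
proof (intro ballI)
  fix F F' assume F: "F \<in> induced \<theta> A" and F': "F' \<in> induced \<theta> B"
  have "L_inner (fourier_coeff \<eta> F) (fourier_coeff \<eta> F') = 0" for \<eta>
  proof (cases "\<eta> \<in> orbit G act \<theta>")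
    case True
    then obtain g where g: "g \<in> carrier G" "\<eta> = act g \<theta>"
      by (auto simp: in_orbit_iff)
    have "L_inner (base_rep (inv g) (fourier_coeff \<eta> F)) (base_rep (inv g) (fourier_coeff \<eta> F')) = 0"
      using assms inducedD(2)[OF F g(1)] inducedD(2)[OF F' g(1)] g(2) by (simp add: L_orthogonal_def)
    then show ?thesis
      using g by (simp add: L_inner_base_rep)
  next
    case False
    then show ?thesis
      using inducedD(1)[OF F] by (simp add: L_inner_def)
  qed
  then show "L_inner F F' = 0"
    by (simp add: L_inner_parseval)
qed

text \<open>The right side is a subrepresentation of the left, so it is induced from its fiber over
  \<open>\<theta>\<close>, and that fiber contains every \<open>A i\<close>.\<close>

lemma induced_subspace_sum:
  assumes I: "finite I" and A: "\<And>i. i \<in> I \<Longrightarrow> subrep (stab_group G \<phi> \<theta>) base_rep (A i)"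
  shows "induced \<theta> (subspace_sum I A) = subspace_sum I (\<lambda>i. induced \<theta> (A i))" (is "?L = ?R")
proof
  have sub: "vec.subspace (subspace_sum I A)"
    using A by (intro subspace_sum_subspace subrep_subspace)
  have ind: "subrep wreath_group wreath_rep (induced \<theta> (A i))" if "i \<in> I" for i
    by (rule subrep_induced[OF subrep_subspace[OF A[OF that]]])
  have R: "subrep wreath_group wreath_rep ?R"
    using ind by (rule subrep_subspace_sum)
  show RL: "?R \<subseteq> ?L"
  proof (rule subspace_sum_least[OF subrep_subspace[OF subrep_induced[OF sub]]])
    fix i assume "i \<in> I"
    then have "A i \<subseteq> subspace_sum I A"
      using A by (intro subspace_sum_upper I subrep_subspace)
    then show "induced \<theta> (A i) \<subseteq> ?L" by (rule induced_mono)
  qed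
  have "A i \<subseteq> fiber \<theta> ?R" if i: "i \<in> I" for i
  proof -
    have "induced \<theta> (A i) \<subseteq> ?R"
      using subspace_sum_upper[OF I i, of "\<lambda>i. induced \<theta> (A i)"] subrep_subspace[OF ind] by blast
    then show ?thesis
      using fiber_induced[OF A[OF i]] by (auto simp: fiber_def)
  qed
  then have "subspace_sum I A \<subseteq> fiber \<theta> ?R"
    by (intro subspace_sum_least subspace_fiber subrep_subspace[OF R])
  then have "?L \<subseteq> induced \<theta> (fiber \<theta> ?R)"
    by (rule induced_mono)
  then show "?L \<subseteq> ?R"
    using induced_fiber_of_subset[OF R RL sub] by simp
qed

text \<open>A relation among the summands, read at the coefficient over
  \<open>act g \<theta>\<close> and translated back by \<open>inv g\<close>, becomes a relation
  among elements of the \<open>A i\<close>, where directness applies.\<close>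

lemma is_direct_sum_induced:
  assumes dir: "is_direct_sum I A U" and A: "\<And>i. i \<in> I \<Longrightarrow> subrep (stab_group G \<phi> \<theta>) base_rep (A i)"
  shows "is_direct_sum I (\<lambda>i. induced \<theta> (A i)) (induced \<theta> U)"
  unfolding is_direct_sum_def
proof (intro conjI ballI allI impI)
  show I: "finite I"
    using dir by (simp add: is_direct_sum_def)
  show "vec.subspace (induced \<theta> (A i))" if "i \<in> I" for i
    by (rule subrep_subspace[OF subrep_induced[OF subrep_subspace[OF A[OF that]]]])
  show "induced \<theta> U = subspace_sum I (\<lambda>i. induced \<theta> (A i))"
    using dir induced_subspace_sum[OF I A] by (simp add: is_direct_sum_def)
  fix v i assume v: "\<forall>i\<in>I. v i \<in> induced \<theta> (A i)" and v0: "(\<Sum>i\<in>I. v i) = 0" and i: "i \<in> I"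
  have zero: "0 \<in> induced \<theta> {0}"
    by (simp add: induced_zero)
  show "v i = 0"
  proof (rule induced_eqI[OF v[rule_format, OF i] zero])
    fix g assume g: "g \<in> carrier G"
    let ?w = "\<lambda>i. base_rep (inv g) (fourier_coeff (act g \<theta>) (v i))"
    have "(\<Sum>i\<in>I. ?w i) = base_rep (inv g) (fourier_coeff (act g \<theta>) (\<Sum>i\<in>I. v i))"
      by (simp add: perm_rep_sum fourier_coeff_sum)
    then have "(\<Sum>i\<in>I. ?w i) = 0" by (simp add: v0)
    moreover have "?w i \<in> A i" if "i \<in> I" for i
      using that v g inducedD(2) by blast
    ultimately have "?w i = 0"
      using is_direct_sum_independentD[OF dir, of ?w] i by blast
    then show "fourier_coeff (act g \<theta>) (v i) = fourier_coeff (act g \<theta>) 0"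
      using g by simp
  qed
qed

text \<open>Different representatives give disjoint supports, so a coefficient over the orbit of
  \<open>\<theta>\<close> involves only the summands indexed by \<open>\<theta>\<close>, and
  directness reduces to that in \<open>L(X)\<close>. The sum is everything because all its fibers
  are: over \<open>\<Theta>\<close> by the given decompositions, elsewhere by translation.\<close>

lemma is_direct_sum_induced_orbits:
  assumes disjoint: "\<And>\<theta> \<theta>'. \<theta> \<in> \<Theta> \<Longrightarrow> \<theta>' \<in> \<Theta> \<Longrightarrow> \<theta> \<in> orbit G act \<theta>' \<Longrightarrow> \<theta> = \<theta>'"
    and cover: "\<And>\<eta>. \<exists>\<theta>\<in>\<Theta>. \<eta> \<in> orbit G act \<theta>"
    and dir: "\<And>\<theta>. \<theta> \<in> \<Theta> \<Longrightarrow> is_direct_sum (I \<theta>) (A \<theta>) UNIV"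
    and A: "\<And>\<theta> i. \<theta> \<in> \<Theta> \<Longrightarrow> i \<in> I \<theta> \<Longrightarrow> subrep (stab_group G \<phi> \<theta>) base_rep (A \<theta> i)"
  shows "is_direct_sum (SIGMA \<theta>:\<Theta>. I \<theta>) (\<lambda>(\<theta>, i). induced \<theta> (A \<theta> i)) UNIV"
    (is "is_direct_sum ?S ?W UNIV")
  unfolding is_direct_sum_def
proof (intro conjI ballI allI impI)
  have fin: "finite \<Theta>" by (rule finite)
  have I: "finite (I \<theta>)" if "\<theta> \<in> \<Theta>" for \<theta>
    using dir[OF that] by (simp add: is_direct_sum_def)
  show S: "finite ?S" using fin I by blast
  have W: "subrep wreath_group wreath_rep (?W p)" if "p \<in> ?S" for p
    using that A by (auto intro!: subrep_induced subrep_subspace)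
  then show "vec.subspace (?W p)" if "p \<in> ?S" for p
    using that by (intro subrep_subspace)
  let ?U = "subspace_sum ?S ?W"
  have U: "subrep wreath_group wreath_rep ?U"
    using W by (rule subrep_subspace_sum)
  have full: "fiber \<theta> ?U = UNIV" if \<theta>: "\<theta> \<in> \<Theta>" for \<theta>
  proof -
    have "A \<theta> i \<subseteq> fiber \<theta> ?U" if i: "i \<in> I \<theta>" for i
    proof -
      have "?W (\<theta>, i) \<subseteq> ?U"
        using \<theta> i subrep_subspace[OF W] by (intro subspace_sum_upper S) auto
      then show ?thesis
        using fiber_induced[OF A[OF \<theta> i]] by (auto simp: fiber_def)
    qed
    then have "subspace_sum (I \<theta>) (A \<theta>) \<subseteq> fiber \<theta> ?U"
      by (intro subspace_sum_least subspace_fiber subrep_subspace[OF U])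
    then show ?thesis
      using dir[OF \<theta>] by (auto simp: is_direct_sum_def)
  qed
  have "fiber \<eta> ?U = UNIV" for \<eta>
  proof -
    obtain \<theta> g where \<theta>: "\<theta> \<in> \<Theta>" and g: "g \<in> carrier G" "\<eta> = act g \<theta>"
      using cover[of \<eta>] by (auto simp: in_orbit_iff)
    have "base_rep g (base_rep (inv g) f) \<in> fiber \<eta> ?U" for f
      unfolding g(2) by (rule base_rep_in_fiber[OF U g(1)]) (simp add: full[OF \<theta>])
    then show ?thesis using g(1) by auto
  qed
  then show "UNIV = ?U"
    using subrep_mem_iff[OF U] by auto
  fix v p assume v: "\<forall>p\<in>?S. v p \<in> ?W p" and v0: "(\<Sum>p\<in>?S. v p) = 0" and "p \<in> ?S"
  then obtain \<theta> i where p: "p = (\<theta>, i)" "\<theta> \<in> \<Theta>" "i \<in> I \<theta>" by auto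
  have v': "v (\<theta>, i) \<in> induced \<theta> (A \<theta> i)" if "\<theta> \<in> \<Theta>" "i \<in> I \<theta>" for \<theta> i
    using v that by auto
  have zero: "0 \<in> induced \<theta> {0}"
    by (simp add: induced_zero)
  show "v p = 0"
    unfolding p(1)
  proof (rule induced_eqI[OF v'[OF p(2,3)] zero])
    fix g assume g: "g \<in> carrier G"
    let ?w = "\<lambda>i. base_rep (inv g) (fourier_coeff (act g \<theta>) (v (\<theta>, i)))"
    have other: "(\<Sum>i\<in>I \<theta>'. fourier_coeff (act g \<theta>) (v (\<theta>', i))) = 0" if "\<theta>' \<in> \<Theta> - {\<theta>}" for \<theta>'
    proof (intro sum.neutral ballI)
      fix i assume i: "i \<in> I \<theta>'"
      have "act g \<theta> \<notin> orbit G act \<theta>'"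
        using disjoint[of \<theta> \<theta>'] p that g by (auto simp: act_in_orbit_iff)
      then show "fourier_coeff (act g \<theta>) (v (\<theta>', i)) = 0"
        using inducedD(1)[OF v'] that i by blast
    qed
    have "0 = fourier_coeff (act g \<theta>) (\<Sum>p\<in>?S. v p)"
      by (simp add: v0)
    also have "\<dots> = (\<Sum>(\<theta>', i)\<in>?S. fourier_coeff (act g \<theta>) (v (\<theta>', i)))"
      by (simp add: fourier_coeff_sum case_prod_unfold)
    also have "\<dots> = (\<Sum>\<theta>'\<in>\<Theta>. \<Sum>i\<in>I \<theta>'. fourier_coeff (act g \<theta>) (v (\<theta>', i)))"
      using I by (intro sum.Sigma[symmetric] fin) blast
    also have "\<dots> = (\<Sum>i\<in>I \<theta>. fourier_coeff (act g \<theta>) (v (\<theta>, i)))"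
      using p(2) other by (subst sum.remove[OF fin p(2)]) simp
    finally have "(\<Sum>i\<in>I \<theta>. ?w i) = 0"
      by (simp flip: perm_rep_sum)
    moreover have "?w i \<in> A \<theta> i" if "i \<in> I \<theta>" for i
      using inducedD(2)[OF v'[OF p(2) that] g] .
    ultimately have "?w i = 0"
      using is_direct_sum_independentD[OF dir[OF p(2)], of ?w] p(3) by blast
    then show "fourier_coeff (act g \<theta>) (v (\<theta>, i)) = fourier_coeff (act g \<theta>) 0"
      using g by simp
  qed
qed

section \<open>Coset and orbit representatives, and the spaces \<open>W\<close>\<close>

text \<open>The coset of \<open>g\<close> consists exactly of the elements that send
  \<open>\<theta>\<close> where \<open>g\<close> does, so evaluation at \<open>\<theta>\<close>
  matches \<open>S\<close> with the orbit.\<close>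

lemma coset_representatives:
  assumes S: "system_of_representatives S (lcosets (stabilizer G act \<theta>))"
  shows "S \<subseteq> carrier G"
    and "inj_on (\<lambda>s. act s \<theta>) S"
    and "orbit G act \<theta> = (\<lambda>s. act s \<theta>) ` S"
proof -
  have coset: "s \<in> g <# stabilizer G act \<theta> \<longleftrightarrow> s \<in> carrier G \<and> act s \<theta> = act g \<theta>"
    if g: "g \<in> carrier G" for g s
  proof
    assume "s \<in> g <# stabilizer G act \<theta>"
    then show "s \<in> carrier G \<and> act s \<theta> = act g \<theta>"
      using g by (auto simp: l_coset_def stabilizer_def act_mult)
  next
    assume s: "s \<in> carrier G \<and> act s \<theta> = act g \<theta>"
    then have "inv g \<otimes> s \<in> stabilizer G act \<theta>"
      using g by (simp add: stabilizer_def act_mult)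
    moreover have "s = g \<otimes> (inv g \<otimes> s)"
      using g s by (simp flip: m_assoc)
    ultimately show "s \<in> g <# stabilizer G act \<theta>"
      unfolding l_coset_def by blast
  qed
  have ex1: "\<exists>!s. s \<in> S \<inter> (g <# stabilizer G act \<theta>)" if "g \<in> carrier G" for g
    using S that by (auto simp: system_of_representatives_def LCOSETS_def)
  show sub: "S \<subseteq> carrier G"
    using S coset by (auto simp: system_of_representatives_def LCOSETS_def)
  show "inj_on (\<lambda>s. act s \<theta>) S"
  proof (rule inj_onI)
    fix s s' assume s: "s \<in> S" "s' \<in> S" "act s \<theta> = act s' \<theta>"
    have carrier: "s \<in> carrier G" "s' \<in> carrier G"
      using s sub by auto
    then have "s \<in> S \<inter> (s <# stabilizer G act \<theta>)" "s' \<in> S \<inter> (s <# stabilizer G act \<theta>)"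
      using s by (simp_all add: coset)
    then show "s = s'"
      using ex1[OF carrier(1)] by blast
  qed
  show "orbit G act \<theta> = (\<lambda>s. act s \<theta>) ` S"
  proof
    show "orbit G act \<theta> \<subseteq> (\<lambda>s. act s \<theta>) ` S"
    proof
      fix \<eta> assume "\<eta> \<in> orbit G act \<theta>"
      then obtain g where g: "g \<in> carrier G" "\<eta> = act g \<theta>"
        by (auto simp: in_orbit_iff)
      obtain s where "s \<in> S \<inter> (g <# stabilizer G act \<theta>)"
        using ex1[OF g(1)] by blast
      then have "s \<in> S" "\<eta> = act s \<theta>"
        using g by (auto simp: coset[OF g(1)])
      then show "\<eta> \<in> (\<lambda>s. act s \<theta>) ` S"
        by blast
    qed
  qed (use sub in auto)
qed

text \<open>Connects the spaces built from coset representatives with the choice-free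
  \<open>induced\<close>. The sum over \<open>S\<close> is direct because different representatives
  give different characters, and it exhausts the induced space by inversion restricted to the
  orbit.\<close>

lemma W_space_induced:
  assumes A: "subrep (stab_group G \<phi> \<theta>) base_rep A"
    and S: "system_of_representatives S (lcosets (stabilizer G act \<theta>))"
  shows "is_direct_sum S (W_summand G \<phi> \<psi> \<theta> A) (W_space G \<phi> \<psi> S \<theta> A)"
    and "W_space G \<phi> \<psi> S \<theta> A = induced \<theta> A"
proof -
  note reps = coset_representatives[OF S]
  let ?w = "W_summand G \<phi> \<psi> \<theta> A"
  note sub = subrep_subspace[OF A] and IA = subrep_induced[OF subrep_subspace[OF A], of \<theta>]
  \<comment> \<open>Finiteness comes from the injection of \<open>S\<close> into the finite type of
    configurations.\<close>
  have fin: "finite S"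
    by (rule finite_imageD[OF finite reps(2)])
  have w_sub: "vec.subspace (?w s)" for s
  proof (rule vec.subspaceI)
    show "0 \<in> ?w s"
      unfolding W_summand_def using vec.subspace_0[OF sub]
      by (auto intro!: exI[of _ 0] image_eqI[of _ _ 0])
  next
    fix F F' assume "F \<in> ?w s" "F' \<in> ?w s"
    then obtain a b where "a \<in> A" "b \<in> A" "F = L_tensor (config_char (act s \<theta>)) (base_rep s a)"
        "F' = L_tensor (config_char (act s \<theta>)) (base_rep s b)"
      by (auto simp: W_summand_def)
    then show "F + F' \<in> ?w s"
      unfolding W_summand_def
      by (intro CollectI exI[of _ "base_rep s (a + b)"])
        (simp add: perm_rep_add L_tensor_add vec.subspace_add[OF sub] image_eqI[of _ _ "a + b"])
  next
    fix c F assume "F \<in> ?w s"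
    then obtain a where "a \<in> A" "F = L_tensor (config_char (act s \<theta>)) (base_rep s a)"
      by (auto simp: W_summand_def)
    then show "c *s F \<in> ?w s"
      unfolding W_summand_def
      by (intro CollectI exI[of _ "base_rep s (c *s a)"])
        (simp add: perm_rep_scale L_tensor_scale vec.subspace_scale[OF sub] image_eqI[of _ _ "c *s a"])
  qed
  show "is_direct_sum S ?w (W_space G \<phi> \<psi> S \<theta> A)"
    unfolding is_direct_sum_def W_space_def
  proof (intro conjI fin ballI w_sub refl allI impI)
    fix v s assume v: "\<forall>s\<in>S. v s \<in> ?w s" and v0: "(\<Sum>s\<in>S. v s) = 0" and s: "s \<in> S"
    have "\<exists>f. v s = L_tensor (config_char (act s \<theta>)) f" if "s \<in> S" for s
      using v that by (auto simp: W_summand_def)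
    then obtain f where f: "\<And>s. s \<in> S \<Longrightarrow> v s = L_tensor (config_char (act s \<theta>)) (f s)"
      by metis
    have "0 = fourier_coeff (act s \<theta>) (\<Sum>s\<in>S. v s)"
      by (simp add: v0)
    also have "\<dots> = (\<Sum>s'\<in>S. if s' = s then f s else 0)"
      unfolding fourier_coeff_sum
    proof (rule sum.cong[OF refl])
      fix s' assume s': "s' \<in> S"
      show "fourier_coeff (act s \<theta>) (v s') = (if s' = s then f s else 0)"
        using inj_on_eq_iff[OF reps(2) s s'] s' by (auto simp: f fourier_coeff_tensor)
    qed
    finally show "v s = 0"
      using fin s f by simp
  qed
  show "W_space G \<phi> \<psi> S \<theta> A = induced \<theta> A"
  proof
    show "W_space G \<phi> \<psi> S \<theta> A \<subseteq> induced \<theta> A"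
      unfolding W_space_def
    proof (rule subspace_sum_least[OF subrep_subspace[OF IA]], rule subsetI)
      fix s F assume s: "s \<in> S" and "F \<in> ?w s"
      then obtain a where a: "a \<in> A" "F = L_tensor (config_char (act s \<theta>)) (base_rep s a)"
        by (auto simp: W_summand_def)
      have "a \<in> fiber \<theta> (induced \<theta> A)"
        using a by (simp add: fiber_induced[OF A])
      then have "base_rep s a \<in> fiber (act s \<theta>) (induced \<theta> A)"
        using s reps(1) by (intro base_rep_in_fiber[OF IA]) auto
      then show "F \<in> induced \<theta> A"
        using a by (simp add: fiber_def)
    qed
    show "induced \<theta> A \<subseteq> W_space G \<phi> \<psi> S \<theta> A"
    proof
      fix F assume F: "F \<in> induced \<theta> A"
      have "F = (\<Sum>\<eta>\<in>UNIV. L_tensor (config_char \<eta>) (fourier_coeff \<eta> F))"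
        by (rule fourier_inversion[symmetric])
      \<comment> \<open>Coefficients off the orbit vanish; the orbit is then parametrized by
        \<open>S\<close>.\<close>
      also have "\<dots> = (\<Sum>\<eta>\<in>orbit G act \<theta>. L_tensor (config_char \<eta>) (fourier_coeff \<eta> F))"
        by (rule sum.mono_neutral_right) (auto simp: inducedD(1)[OF F])
      also have "\<dots> = (\<Sum>s\<in>S. L_tensor (config_char (act s \<theta>)) (fourier_coeff (act s \<theta>) F))"
        unfolding reps(3) by (simp add: sum.reindex[OF reps(2)])
      finally have F_eq: "F = (\<Sum>s\<in>S. L_tensor (config_char (act s \<theta>)) (fourier_coeff (act s \<theta>) F))" .
      have "L_tensor (config_char (act s \<theta>)) (fourier_coeff (act s \<theta>) F) \<in> ?w s" if "s \<in> S" for s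
      proof -
        have s: "s \<in> carrier G" using that reps(1) by blast
        then have "fourier_coeff (act s \<theta>) F = base_rep s (base_rep (inv s) (fourier_coeff (act s \<theta>) F))"
          by simp
        then show ?thesis
          unfolding W_summand_def using inducedD(2)[OF F s] by blast
      qed
      then show "F \<in> W_space G \<phi> \<psi> S \<theta> A"
        unfolding W_space_def subspace_sum_def using F_eq by blast
    qed
  qed
qed

text \<open>Lying in one orbit is symmetric, so \<open>\<eta>\<close> belongs to the orbit of the
  representative that is found in the orbit of \<open>\<eta>\<close>.\<close>

lemma orbit_representatives:
  assumes \<Theta>: "system_of_representatives \<Theta> (orbits G UNIV act)"
  shows "\<theta> \<in> \<Theta> \<Longrightarrow> \<theta>' \<in> \<Theta> \<Longrightarrow> \<theta> \<in> orbit G act \<theta>' \<Longrightarrow> \<theta> = \<theta>'"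
    and "\<exists>\<theta>\<in>\<Theta>. \<eta> \<in> orbit G act \<theta>"
proof -
  have ex1: "\<exists>!\<theta>. \<theta> \<in> \<Theta> \<inter> orbit G act \<eta>" for \<eta>
    using \<Theta> by (auto simp: system_of_representatives_def orbits_def)
  show "\<theta> = \<theta>'" if "\<theta> \<in> \<Theta>" "\<theta>' \<in> \<Theta>" "\<theta> \<in> orbit G act \<theta>'"
    using ex1[of \<theta>'] that orbit_self by blast
  obtain \<theta> where "\<theta> \<in> \<Theta>" "\<theta> \<in> orbit G act \<eta>"
    using ex1[of \<eta>] by blast
  moreover then obtain g where "g \<in> carrier G" "\<theta> = act g \<eta>"
    by (auto simp: in_orbit_iff)
  ultimately have "\<theta> \<in> \<Theta> \<and> \<eta> \<in> orbit G act \<theta>"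
    using act_in_orbit_iff[of g \<eta> \<theta>] by simp
  then show "\<exists>\<theta>\<in>\<Theta>. \<eta> \<in> orbit G act \<theta>" by blast
qed

end

section \<open>Transport of the decompositions from the stabilizers to the wreath product\<close>

theorem theorem7p6:
  fixes G :: "('g, 'm) monoid_scheme"
    and \<phi> :: "'g \<Rightarrow> 'z::finite \<Rightarrow> 'z"
    and \<psi> :: "'g \<Rightarrow> 'x::finite \<Rightarrow> 'x"
    and \<Theta> :: "('z \<Rightarrow> bit) set"
    and n :: "('z \<Rightarrow> bit) \<Rightarrow> nat"
    and m :: "('z \<Rightarrow> bit) \<Rightarrow> nat \<Rightarrow> nat"
    and V :: "('z \<Rightarrow> bit) \<Rightarrow> nat \<Rightarrow> nat \<Rightarrow> (complex ^ 'x) set"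
    and S :: "('z \<Rightarrow> bit) \<Rightarrow> 'g set"
  assumes "group G" and "finite (carrier G)"
    and "transitive_action G (UNIV :: 'z set) \<phi>"
    and "transitive_action G (UNIV :: 'x set) \<psi>"
    and "system_of_representatives \<Theta> (orbits G UNIV (config_act G \<phi>))"
    and "\<And>\<theta>. \<theta> \<in> \<Theta> \<Longrightarrow>
           isotypic_decomposition (stab_group G \<phi> \<theta>) (perm_rep G \<psi>) UNIV {0..n \<theta>} (m \<theta>) (V \<theta>)"
    and "\<And>\<theta>. \<theta> \<in> \<Theta> \<Longrightarrow>
           system_of_representatives (S \<theta>) (lcosets\<^bsub>G\<^esub> (stabilizer G (config_act G \<phi>) \<theta>)) \<and>
           \<one>\<^bsub>G\<^esub> \<in> S \<theta>"
  shows "(\<forall>\<theta>\<in>\<Theta>. \<forall>i\<in>{0..n \<theta>}. \<forall>j\<in>{1..m \<theta> i}.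
            is_direct_sum (S \<theta>) (W_summand G \<phi> \<psi> \<theta> (V \<theta> i j)) (W_space G \<phi> \<psi> (S \<theta>) \<theta> (V \<theta> i j))) \<and>
         isotypic_decomposition (C2_wreath G \<phi>) (perm_rep (C2_wreath G \<phi>) (wreath_act G \<phi> \<psi>)) UNIV
            (SIGMA \<theta>:\<Theta>. {0..n \<theta>})
            (\<lambda>(\<theta>, i). m \<theta> i)
            (\<lambda>(\<theta>, i) j. W_space G \<phi> \<psi> (S \<theta>) \<theta> (V \<theta> i j))"
proof -
  interpret wreath_action G \<phi> \<psi>
    using assms(1,3,4) by (simp add: wreath_action_def transitive_action_def)
  have dir: "is_direct_sum {0..n \<theta>} (\<lambda>i. subspace_sum {1..m \<theta> i} (V \<theta> i)) UNIV"
    and m_pos: "\<And>i. i \<in> {0..n \<theta>} \<Longrightarrow> 0 < m \<theta> i"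
    and irr: "\<And>i j. i \<in> {0..n \<theta>} \<Longrightarrow> j \<in> {1..m \<theta> i} \<Longrightarrow>
      irreducible_subrep (stab_group G \<phi> \<theta>) base_rep (V \<theta> i j)"
    and eqv: "\<And>i j i' j'. i \<in> {0..n \<theta>} \<Longrightarrow> j \<in> {1..m \<theta> i} \<Longrightarrow>
      i' \<in> {0..n \<theta>} \<Longrightarrow> j' \<in> {1..m \<theta> i'} \<Longrightarrow>
      equivalent_subreps (stab_group G \<phi> \<theta>) base_rep (V \<theta> i j) (V \<theta> i' j') \<longleftrightarrow> i = i'"
    and orth: "\<And>i j. i \<in> {0..n \<theta>} \<Longrightarrow> j \<in> {1..m \<theta> i} \<Longrightarrow>
      is_orthogonal_sum {1..m \<theta> i} (V \<theta> i)
        (isotypic_component (stab_group G \<phi> \<theta>) base_rep UNIV (V \<theta> i j))"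
    if "\<theta> \<in> \<Theta>" for \<theta>
    using assms(6)[OF that] unfolding isotypic_decomposition_def by blast+
  have V: "subrep (stab_group G \<phi> \<theta>) base_rep (V \<theta> i j)" and V_nz: "V \<theta> i j \<noteq> {0}"
    if "\<theta> \<in> \<Theta>" "i \<in> {0..n \<theta>}" "j \<in> {1..m \<theta> i}" for \<theta> i j
    using irr[OF that] by (simp_all add: irreducible_subrep_def)
  have W: "W_space G \<phi> \<psi> (S \<theta>) \<theta> (V \<theta> i j) = induced \<theta> (V \<theta> i j)"
    and W_dir: "is_direct_sum (S \<theta>) (W_summand G \<phi> \<psi> \<theta> (V \<theta> i j)) (W_space G \<phi> \<psi> (S \<theta>) \<theta> (V \<theta> i j))"
    if "\<theta> \<in> \<Theta>" "i \<in> {0..n \<theta>}" "j \<in> {1..m \<theta> i}" for \<theta> i j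
    using W_space_induced[OF V[OF that]] assms(7)[OF that(1)] by blast+
  let ?W = "\<lambda>\<theta> i j. W_space G \<phi> \<psi> (S \<theta>) \<theta> (V \<theta> i j)"
  note reps = orbit_representatives[OF assms(5)]
  \<comment> \<open>Inducing commutes with the sum inside a block, so each block for the wreath
    product is induced from a block for the stabilizer.\<close>
  have sum_W: "subspace_sum {1..m \<theta> i} (?W \<theta> i) = induced \<theta> (subspace_sum {1..m \<theta> i} (V \<theta> i))"
    if "\<theta> \<in> \<Theta>" "i \<in> {0..n \<theta>}" for \<theta> i
  proof -
    have "subspace_sum {1..m \<theta> i} (?W \<theta> i) = subspace_sum {1..m \<theta> i} (\<lambda>j. induced \<theta> (V \<theta> i j))"
      by (rule subspace_sum_cong) (rule W[OF that])
    also have "\<dots> = induced \<theta> (subspace_sum {1..m \<theta> i} (V \<theta> i))"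
      using V[OF that] by (intro induced_subspace_sum[symmetric]) simp_all
    finally show ?thesis .
  qed
  \<comment> \<open>Whole blocks are induced here, since the decompositions of \<open>L(X)\<close>
    are given as direct sums of blocks.\<close>
  have "is_direct_sum (SIGMA \<theta>:\<Theta>. {0..n \<theta>})
      (\<lambda>(\<theta>, i). induced \<theta> (subspace_sum {1..m \<theta> i} (V \<theta> i))) UNIV"
    using V by (intro is_direct_sum_induced_orbits reps dir subrep_subspace_sum)
  then have total: "is_direct_sum (SIGMA \<theta>:\<Theta>. {0..n \<theta>})
      (\<lambda>(\<theta>, i). subspace_sum {1..m \<theta> i} (?W \<theta> i)) UNIV"
    by (rule is_direct_sum_cong[THEN iffD1, rotated]) (clarify, simp only: prod.case sum_W)
  have W_irr: "irreducible_subrep wreath_group wreath_rep (?W \<theta> i j)"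
    if "\<theta> \<in> \<Theta>" "i \<in> {0..n \<theta>}" "j \<in> {1..m \<theta> i}" for \<theta> i j
    unfolding W[OF that] by (rule irreducible_induced[OF irr[OF that]])
  have W_eqv: "equivalent_subreps wreath_group wreath_rep (?W \<theta> i j) (?W \<theta>' i' j') \<longleftrightarrow> (\<theta>, i) = (\<theta>', i')"
    if p: "\<theta> \<in> \<Theta>" "i \<in> {0..n \<theta>}" "j \<in> {1..m \<theta> i}"
      and p': "\<theta>' \<in> \<Theta>" "i' \<in> {0..n \<theta>'}" "j' \<in> {1..m \<theta>' i'}" for \<theta> i j \<theta>' i' j'
  \<comment> \<open>Over one representative, equivalence is decided by the stabilizer; over
    different ones, the supports lie in different orbits.\<close>
  proof (cases "\<theta> = \<theta>'")
    case True
    show ?thesis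
      using equivalent_induced_iff[OF V[OF p] V[OF p'[folded True]]] eqv[OF p p'(2,3)[folded True]] True
      unfolding W[OF p] W[OF p'] by simp
  next
    case False
    then have "\<theta> \<notin> orbit G act \<theta>'"
      using reps(1)[OF p(1) p'(1)] by blast
    then show ?thesis
      using not_equivalent_induced[OF V[OF p] V_nz[OF p] subrep_subspace[OF V[OF p']]] False
      unfolding W[OF p] W[OF p'] by simp
  qed
  have W_orth: "is_orthogonal_sum {1..m \<theta> i} (?W \<theta> i)
      (isotypic_component wreath_group wreath_rep UNIV (?W \<theta> i j))"
    if p: "\<theta> \<in> \<Theta>" "i \<in> {0..n \<theta>}" "j \<in> {1..m \<theta> i}" for \<theta> i j
  proof -
    \<comment> \<open>The isotypic component of the wreath product is induced from
      \<open>?C\<close>, so directness and orthogonality both come from the decomposition of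
      \<open>?C\<close>.\<close>
    let ?C = "isotypic_component (stab_group G \<phi> \<theta>) base_rep UNIV (V \<theta> i j)"
    have "is_direct_sum {1..m \<theta> i} (\<lambda>j. induced \<theta> (V \<theta> i j)) (induced \<theta> ?C)"
      using orth[OF p] V[OF p(1,2)] unfolding is_orthogonal_sum_def by (blast intro: is_direct_sum_induced)
    then have "is_direct_sum {1..m \<theta> i} (?W \<theta> i) (induced \<theta> ?C)"
      by (rule is_direct_sum_cong[THEN iffD1, rotated]) (simp add: W[OF p(1,2)])
    moreover have "L_orthogonal (?W \<theta> i k) (?W \<theta> i l)"
      if "k \<in> {1..m \<theta> i}" "l \<in> {1..m \<theta> i}" "k \<noteq> l" for k l
      unfolding W[OF p(1,2) that(1)] W[OF p(1,2) that(2)]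
      using orth[OF p] that unfolding is_orthogonal_sum_def by (blast intro: L_orthogonal_induced)
    ultimately show ?thesis
      unfolding is_orthogonal_sum_def W[OF p] isotypic_component_induced[OF V[OF p]] by blast
  qed
  show ?thesis
    unfolding isotypic_decomposition_def
  proof (intro conjI ballI)
    show "is_direct_sum (SIGMA \<theta>:\<Theta>. {0..n \<theta>})
        (\<lambda>p. subspace_sum {1..(case p of (\<theta>, i) \<Rightarrow> m \<theta> i)} (case p of (\<theta>, i) \<Rightarrow> ?W \<theta> i)) UNIV"
      using total by (simp add: case_prod_unfold)
  qed (use W_dir m_pos W_irr W_eqv W_orth in \<open>auto simp del: prod.inject\<close>)
qed

end
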